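(* Let $p\in[1,\infty]$ and $r\in(1,\infty)$. Let $I=(0,T)$ with $T\in(0,\infty)$ or $I=\mathbb R_+$. Then the diagonal operator $A$ on $X_{1,r}=\ell^1(\ell^r)$, given by $(Ax)_{m,n}=2^nx_{m,n}$ with its natural maximal domain, does not have maximal $L^p$-regularity on $I$.
   Context: All Banach spaces are complex; $\mathbb R_+=(0,\infty)$. $X_{1,r}=\ell^1(\ell^r)$ is the space of scalar double sequences $x=(x_{m,n})_{m,n\ge1}$ with $\|x\|=\sum_{m\ge1}(\sum_{n\ge1}|x_{m,n}|^r)^{1/r}<\infty$. The operator $A$ is $(Ax)_{m,n}:=2^nx_{m,n}$ with domain $\{x\in X_{1,r}:(2^nx_{m,n})_{m,n}\in X_{1,r}\}$; $-A$ generates the analytic $C_0$-semigroup $(S(t)x)_{m,n}=e^{-2^nt}x_{m,n}$. Maximal $L^p$-regularity: let $A$ be a densely defined sectorial operator on a Banach space $X$ such that $-A$ generates an analytic $C_0$-semigroup $(S(t))_{t\ge0}$. For $f\in L^1_{\rm loc}(\overline I;X)$ put $u_f(t):=\int_0^tS(t-s)f(s)\,ds$, $t\in I$. For $p\in[1,\infty]$, $A$ has maximal $L^p$-regularity on $I$ if there is a constant $C$ such that for all $f\in L^p(I;X)$ one has $u_f(t)\in \mathsf D(A)$ for almost all $t\in I$ and $\|Au_f\|_{L^p(I;X)}\le C\|f\|_{L^p(I;X)}$. *)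

theory Defs
  imports
    "HOL-Analysis.Analysis"
    "HOL-Probability.Essential_Supremum"
    "HOL-Library.Function_Algebras"
begin

text \<open>The space \<open>\<ell>\<^sup>1(\<ell>\<^sup>r)\<close> depends on the real number \<open>r\<close>, so it cannot be a type of class
  \<open>banach\<close>, and the library's Bochner integral is not available for functions with values in it.
  Complex Banach spaces are therefore represented by a carrier set inside a type of class
  \<open>ab_group_add\<close>, with explicit scalar multiplication and norm; the norm is meaningful on the
  carrier only. The vector-valued integral below follows the library's
  \<open>has_bochner_integral\<close>.\<close>

section \<open>Complex Banach spaces and operators\<close>

record 'v cnormed =
  carr :: "'v set"
  scl :: "complex \<Rightarrow> 'v \<Rightarrow> 'v"
  nrm :: "'v \<Rightarrow> real"

definition complex_banach :: "'v::ab_group_add cnormed \<Rightarrow> bool" where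
  "complex_banach V \<longleftrightarrow>
     vector_space (scl V) \<and> module.subspace (scl V) (carr V) \<and>
     (\<forall>x\<in>carr V. 0 \<le> nrm V x \<and> (nrm V x = 0 \<longleftrightarrow> x = 0)) \<and>
     (\<forall>c. \<forall>x\<in>carr V. nrm V (scl V c x) = cmod c * nrm V x) \<and>
     (\<forall>x\<in>carr V. \<forall>y\<in>carr V. nrm V (x + y) \<le> nrm V x + nrm V y) \<and>
     (\<forall>s. range s \<subseteq> carr V \<and>
          (\<forall>e>0. \<exists>N::nat. \<forall>i\<ge>N. \<forall>j\<ge>N. nrm V (s i - s j) < e) \<longrightarrow>
          (\<exists>x\<in>carr V. (\<lambda>i. nrm V (s i - x)) \<longlonglongrightarrow> 0))"

definition bounded_op :: "'v::ab_group_add cnormed \<Rightarrow> ('v \<Rightarrow> 'v) \<Rightarrow> bool" where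
  "bounded_op V T \<longleftrightarrow>
     (\<forall>x\<in>carr V. T x \<in> carr V) \<and>
     (\<forall>x\<in>carr V. \<forall>y\<in>carr V. T (x + y) = T x + T y) \<and>
     (\<forall>c. \<forall>x\<in>carr V. T (scl V c x) = scl V c (T x)) \<and>
     (\<exists>K. \<forall>x\<in>carr V. nrm V (T x) \<le> K * nrm V x)"

text \<open>An unbounded operator is given by its domain \<open>D\<close> and a function \<open>A\<close> whose values
  outside \<open>D\<close> are irrelevant.\<close>

definition densely_defined :: "'v::ab_group_add cnormed \<Rightarrow> 'v set \<Rightarrow> ('v \<Rightarrow> 'v) \<Rightarrow> bool" where
  "densely_defined V D A \<longleftrightarrow>
     D \<subseteq> carr V \<and> module.subspace (scl V) D \<and>
     (\<forall>x\<in>D. A x \<in> carr V) \<and>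
     (\<forall>x\<in>D. \<forall>y\<in>D. A (x + y) = A x + A y) \<and>
     (\<forall>c. \<forall>x\<in>D. A (scl V c x) = scl V c (A x)) \<and>
     (\<forall>x\<in>carr V. \<forall>e>0. \<exists>y\<in>D. nrm V (x - y) < e)"

text \<open>The spectrum of \<open>A\<close> lies in a closed sector of half-angle \<open>\<omega> < \<pi>\<close> around the positive real
  axis, and \<open>z (z - A)\<^sup>-\<^sup>1\<close> is uniformly bounded for \<open>z\<close> outside that sector.\<close>

definition sectorial :: "'v::ab_group_add cnormed \<Rightarrow> 'v set \<Rightarrow> ('v \<Rightarrow> 'v) \<Rightarrow> bool" where
  "sectorial V D A \<longleftrightarrow>
     (\<exists>\<omega>\<in>{0<..<pi}. \<exists>M. \<forall>z. z \<noteq> 0 \<and> \<omega> < \<bar>Arg z\<bar> \<longrightarrow>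
        (\<exists>R. bounded_op V R \<and>
             (\<forall>x\<in>carr V. R x \<in> D \<and> scl V z (R x) - A (R x) = x) \<and>
             (\<forall>x\<in>D. R (scl V z x - A x) = x) \<and>
             (\<forall>x\<in>carr V. nrm V (scl V z (R x)) \<le> M * nrm V x)))"

section \<open>Semigroups\<close>

definition C0_semigroup :: "'v::ab_group_add cnormed \<Rightarrow> (real \<Rightarrow> 'v \<Rightarrow> 'v) \<Rightarrow> bool" where
  "C0_semigroup V S \<longleftrightarrow>
     (\<forall>t\<ge>0. bounded_op V (S t)) \<and>
     (\<forall>x\<in>carr V. S 0 x = x) \<and>
     (\<forall>s\<ge>0. \<forall>t\<ge>0. \<forall>x\<in>carr V. S (s + t) x = S s (S t x)) \<and>
     (\<forall>x\<in>carr V. ((\<lambda>t. nrm V (S t x - x)) \<longlongrightarrow> 0) (at_right 0))"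

definition generator_of ::
    "'v::ab_group_add cnormed \<Rightarrow> (real \<Rightarrow> 'v \<Rightarrow> 'v) \<Rightarrow> 'v set \<Rightarrow> ('v \<Rightarrow> 'v) \<Rightarrow> bool" where
  "generator_of V S D B \<longleftrightarrow>
     D \<subseteq> carr V \<and> (\<forall>x\<in>D. B x \<in> carr V) \<and>
     (\<forall>x\<in>carr V. \<forall>y\<in>carr V. x \<in> D \<and> B x = y \<longleftrightarrow>
        ((\<lambda>h. nrm V (scl V (complex_of_real (1 / h)) (S h x - x) - y)) \<longlongrightarrow> 0) (at_right 0))"

definition sector :: "real \<Rightarrow> complex set" where
  "sector \<theta> = {z. z \<noteq> 0 \<and> \<bar>Arg z\<bar> < \<theta>}"

definition analytic_semigroup :: "'v::ab_group_add cnormed \<Rightarrow> (real \<Rightarrow> 'v \<Rightarrow> 'v) \<Rightarrow> bool" where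
  "analytic_semigroup V S \<longleftrightarrow>
     C0_semigroup V S \<and>
     (\<exists>\<theta>\<in>{0<..pi/2}. \<exists>T :: complex \<Rightarrow> 'v \<Rightarrow> 'v.
        (\<forall>t>0. \<forall>x\<in>carr V. T (complex_of_real t) x = S t x) \<and>
        (\<forall>z\<in>sector \<theta>. bounded_op V (T z)) \<and>
        (\<forall>z\<in>sector \<theta>. \<forall>w\<in>sector \<theta>. \<forall>x\<in>carr V. T (z + w) x = T z (T w x)) \<and>
        (\<forall>x\<in>carr V. \<forall>z\<in>sector \<theta>. \<exists>y\<in>carr V.
           ((\<lambda>w. nrm V (scl V (1 / (w - z)) (T w x - T z x) - y)) \<longlongrightarrow> 0) (at z)) \<and>
        (\<forall>\<theta>'\<in>{0<..<\<theta>}. \<forall>x\<in>carr V.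
           ((\<lambda>z. nrm V (T z x - x)) \<longlongrightarrow> 0) (at 0 within sector \<theta>')))"

section \<open>Vector-valued integration\<close>

definition strongly_measurable ::
    "'v::ab_group_add cnormed \<Rightarrow> 'a measure \<Rightarrow> ('a \<Rightarrow> 'v) \<Rightarrow> bool" where
  "strongly_measurable V M f \<longleftrightarrow>
     (AE x in M. f x \<in> carr V) \<and>
     (\<exists>s. (\<forall>k::nat. simple_function M (s k) \<and> s k ` space M \<subseteq> carr V) \<and>
          (AE x in M. (\<lambda>k. nrm V (f x - s k x)) \<longlonglongrightarrow> 0))"

definition simple_integrable_on ::
    "'v::ab_group_add cnormed \<Rightarrow> 'a measure \<Rightarrow> ('a \<Rightarrow> 'v) \<Rightarrow> bool" where
  "simple_integrable_on V M s \<longleftrightarrow>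
     simple_function M s \<and> s ` space M \<subseteq> carr V \<and> emeasure M {x\<in>space M. s x \<noteq> 0} \<noteq> \<infinity>"

definition simple_integral_on ::
    "'v::ab_group_add cnormed \<Rightarrow> 'a measure \<Rightarrow> ('a \<Rightarrow> 'v) \<Rightarrow> 'v" where
  "simple_integral_on V M s =
     (\<Sum>y\<in>s ` space M. scl V (complex_of_real (measure M {x\<in>space M. s x = y})) y)"

definition has_bochner_integral_on ::
    "'v::ab_group_add cnormed \<Rightarrow> 'a measure \<Rightarrow> ('a \<Rightarrow> 'v) \<Rightarrow> 'v \<Rightarrow> bool" where
  "has_bochner_integral_on V M f y \<longleftrightarrow>
     strongly_measurable V M f \<and> y \<in> carr V \<and>
     (\<exists>s. (\<forall>k::nat. simple_integrable_on V M (s k)) \<and>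
          (\<lambda>k. \<integral>\<^sup>+x. ennreal (nrm V (f x - s k x)) \<partial>M) \<longlonglongrightarrow> 0 \<and>
          (\<lambda>k. nrm V (simple_integral_on V M (s k) - y)) \<longlonglongrightarrow> 0)"

definition bochner_integral_on ::
    "'v::ab_group_add cnormed \<Rightarrow> 'a measure \<Rightarrow> ('a \<Rightarrow> 'v) \<Rightarrow> 'v" where
  "bochner_integral_on V M f =
     (if \<exists>y. has_bochner_integral_on V M f y then THE y. has_bochner_integral_on V M f y else 0)"

definition Lp_norm ::
    "'v::ab_group_add cnormed \<Rightarrow> 'a measure \<Rightarrow> ennreal \<Rightarrow> ('a \<Rightarrow> 'v) \<Rightarrow> ennreal" where
  "Lp_norm V M p f =
     (if p = \<infinity> then esssup M (\<lambda>x. ennreal (nrm V (f x)))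
      else let J = (\<integral>\<^sup>+x. ennreal (nrm V (f x) powr enn2real p) \<partial>M)
           in if J = \<infinity> then \<infinity> else ennreal (enn2real J powr (1 / enn2real p)))"

definition Lp_space ::
    "'v::ab_group_add cnormed \<Rightarrow> 'a measure \<Rightarrow> ennreal \<Rightarrow> ('a \<Rightarrow> 'v) set" where
  "Lp_space V M p = {f. strongly_measurable V M f \<and> Lp_norm V M p f < \<infinity>}"

section \<open>Maximal regularity\<close>

definition mild_solution ::
    "'v::ab_group_add cnormed \<Rightarrow> (real \<Rightarrow> 'v \<Rightarrow> 'v) \<Rightarrow> (real \<Rightarrow> 'v) \<Rightarrow> real \<Rightarrow> 'v" where
  "mild_solution V S f t =
     bochner_integral_on V (lebesgue_on {0<..<t}) (\<lambda>s. S (t - s) (f s))"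

text \<open>The premises of the implication are the standing assumptions under which maximal regularity
  is considered; the semigroup \<open>S\<close> is uniquely determined by its generator \<open>-A\<close>. Consequently
  the negation of this predicate includes the assertion that these assumptions hold.\<close>

definition maximal_Lp_regularity ::
    "'v::ab_group_add cnormed \<Rightarrow> 'v set \<Rightarrow> ('v \<Rightarrow> 'v) \<Rightarrow> ennreal \<Rightarrow> real set \<Rightarrow> bool" where
  "maximal_Lp_regularity V D A p I \<longleftrightarrow>
     (\<forall>S. complex_banach V \<and> densely_defined V D A \<and> sectorial V D A \<and>
          analytic_semigroup V S \<and> generator_of V S D (\<lambda>x. - A x) \<longrightarrow>
        (\<exists>C::real. \<forall>f\<in>Lp_space V (lebesgue_on I) p.
           (AE t in lebesgue_on I. mild_solution V S f t \<in> D) \<and>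
           (\<lambda>t. A (mild_solution V S f t)) \<in> Lp_space V (lebesgue_on I) p \<and>
           Lp_norm V (lebesgue_on I) p (\<lambda>t. A (mild_solution V S f t))
             \<le> ennreal C * Lp_norm V (lebesgue_on I) p f))"

section \<open>The space and the diagonal operator\<close>

text \<open>Sequences are indexed from \<open>0\<close>: the value \<open>x m n\<close> stands for \<open>x\<^bsub>m+1,n+1\<^esub>\<close>. This is why
  the exponent in \<open>diag_op\<close> is \<open>Suc n\<close>.\<close>

definition l1_lr :: "real \<Rightarrow> (nat \<Rightarrow> nat \<Rightarrow> complex) cnormed" where
  "l1_lr r =
     \<lparr>carr = {x. (\<forall>m. summable (\<lambda>n. cmod (x m n) powr r)) \<and>
                 summable (\<lambda>m. (\<Sum>n. cmod (x m n) powr r) powr (1 / r))},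
      scl = (\<lambda>c x m n. c * x m n),
      nrm = (\<lambda>x. \<Sum>m. (\<Sum>n. cmod (x m n) powr r) powr (1 / r))\<rparr>"

definition diag_op :: "(nat \<Rightarrow> nat \<Rightarrow> complex) \<Rightarrow> nat \<Rightarrow> nat \<Rightarrow> complex" where
  "diag_op x = (\<lambda>m n. 2 ^ Suc n * x m n)"

definition diag_dom :: "real \<Rightarrow> (nat \<Rightarrow> nat \<Rightarrow> complex) set" where
  "diag_dom r = {x \<in> carr (l1_lr r). diag_op x \<in> carr (l1_lr r)}"

end

theory Submission
  imports Defs
begin

text \<open>
Write \<open>X = \<ell>\<^sup>1(\<ell>\<^sup>r)\<close> and \<open>a\<^sub>n = 2\<^sup>n\<^sup>+\<^sup>1\<close> for the diagonal entries of \<open>A\<close>. On a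
single row \<open>\<ell>\<^sup>r\<close> the operator has maximal \<open>L\<^sup>p\<close>-regularity for \<open>1 < p < \<infinity>\<close>, but not for \<open>p = 1\<close>.
The outer \<open>\<ell>\<^sup>1\<close> carries the failure at \<open>p = 1\<close> over to every exponent: if row \<open>m\<close> is driven by the same
pulse delayed by \<open>m\<delta>\<close>, then summing the row norms over \<open>m\<close> at a fixed time amounts to integrating
the response to one pulse over time.

Concretely, fix \<open>\<tau> > 0\<close> with \<open>(0, 2\<tau>) \<subseteq> I\<close>, put \<open>\<delta> = \<tau> / 2\<^sup>N\<close> and let row \<open>m < 2\<^sup>N\<^sup>+\<^sup>1\<close> of the datum
be the vector \<open>(1, \<dots>, 1, 0, \<dots>)\<close> with \<open>N\<close> ones, switched on exactly during the time slot
\<open>[m\<delta>, (m+1)\<delta>)\<close>. One row is active at each time in \<open>[0, 2\<tau>)\<close>, so the datum has constant norm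
\<open>N\<^sup>1\<^sup>/\<^sup>r\<close> there. At a time \<open>t\<close> in \<open>[\<tau>, 2\<tau>)\<close> at least \<open>2\<^sup>N\<close> slots have passed. The row whose slot lies
\<open>j\<close> steps back, with \<open>2\<^sup>i \<le> j < 2\<^sup>i\<^sup>+\<^sup>1\<close>, has a coordinate with \<open>a\<^sub>n \<delta> = \<tau> / 2\<^sup>i\<close>, and there
\<open>A u(t)\<close> is at least \<open>a\<^sub>n \<delta> e\<^sup>-\<^sup>2\<^sup>\<tau>\<close>. The \<open>2\<^sup>i\<close> rows of each dyadic block thus contribute
\<open>\<tau> e\<^sup>-\<^sup>2\<^sup>\<tau>\<close> together, and the \<open>N\<close> blocks give \<open>\<parallel>A u(t)\<parallel> \<ge> N \<tau> e\<^sup>-\<^sup>2\<^sup>\<tau>\<close> (lemmas \<open>response_lower_bound\<close>,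
\<open>dyadic_sum_lower_bound\<close>, \<open>nrm_regular_solution_ge\<close>). Both estimates hold pointwise in
time on intervals of length \<open>2\<tau>\<close> and \<open>\<tau>\<close>, so for every \<open>p\<close> a regularity constant \<open>C\<close> would satisfy
\<open>N \<tau> e\<^sup>-\<^sup>2\<^sup>\<tau> \<le> 2 C N\<^sup>1\<^sup>/\<^sup>r\<close> for all \<open>N\<close>, which is absurd since \<open>r > 1\<close>.

Maximal regularity is a statement under standing assumptions, and its negation includes them. The
space is shown to be a Banach space through the description of its norm by finite partial sums
(\<open>l1_lr_norm_le_iff\<close>). Sectoriality, analyticity and the generator property all reduce
to scalar estimates for multipliers, the passage to the norm being made by domination
(\<open>l1_lr_dominated\<close>) and by dominated convergence (\<open>l1_lr_dominated_convergence\<close>). Since the data have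
finite support, the vector-valued integral defining \<open>u\<close> reduces to
scalar integrals (\<open>bochner_integral_on_block\<close>).
\<close>

section \<open>The norm of \<open>\<ell>\<^sup>1(\<ell>\<^sup>r)\<close>\<close>

definition partial_norm :: "real \<Rightarrow> (nat \<Rightarrow> nat \<Rightarrow> complex) \<Rightarrow> nat \<Rightarrow> nat \<Rightarrow> real" where
  "partial_norm r x M N = (\<Sum>m<M. (\<Sum>n<N. cmod (x m n) powr r) powr (1 / r))"

text \<open>Convexity of \<open>x\<^sup>r\<close> on the open half-line leaves out the boundary points, where the claim is that
  \<open>s\<^sup>r \<le> s\<close> for \<open>s\<close> in the unit interval.\<close>

lemma powr_convex_nonneg:
  fixes x y t r :: real
  assumes "1 \<le> r" "0 \<le> x" "0 \<le> y" "0 \<le> t" "t \<le> 1"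
  shows "(t * x + (1 - t) * y) powr r \<le> t * x powr r + (1 - t) * y powr r"
proof -
  have small: "s powr r \<le> s" if "0 \<le> s" "s \<le> 1" for s
    using powr_mono'[of 1 r s] that assms by auto
  consider "x = 0" | "y = 0" | "x > 0" "y > 0" using assms by linarith
  then show ?thesis
  proof cases
    case 1
    then show ?thesis using small[of "1-t"] assms by (simp add: powr_mult mult_right_mono)
  next
    case 2
    then show ?thesis using small[of t] assms by (simp add: powr_mult mult_right_mono)
  next
    case 3
    have "convex_on {0<..} (\<lambda>x::real. x powr r)"
      using powr_convex[OF assms(1)] .
    from convex_onD[OF this, of t y x] 3 assms show ?thesis by (simp add: algebra_simps)
  qed
qed

text \<open>With \<open>a\<close>, \<open>b\<close> the two norms on the right, \<open>f + g\<close> divided by \<open>a + b\<close> is a convex combination of the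
  unit vectors \<open>f / a\<close> and \<open>g / b\<close>; convexity of \<open>x\<^sup>r\<close> is applied to it term by term.\<close>

lemma minkowski_sum:
  fixes f g :: "'i \<Rightarrow> 'a::real_normed_vector"
  assumes r: "1 \<le> r" and A: "finite A"
  shows "(\<Sum>i\<in>A. norm (f i + g i) powr r) powr (1 / r)
       \<le> (\<Sum>i\<in>A. norm (f i) powr r) powr (1 / r) + (\<Sum>i\<in>A. norm (g i) powr r) powr (1 / r)"
proof -
  define a where "a = (\<Sum>i\<in>A. norm (f i) powr r) powr (1 / r)"
  define b where "b = (\<Sum>i\<in>A. norm (g i) powr r) powr (1 / r)"
  have ar: "a powr r = (\<Sum>i\<in>A. norm (f i) powr r)" and br: "b powr r = (\<Sum>i\<in>A. norm (g i) powr r)"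
    using r by (simp_all add: a_def b_def powr_powr sum_nonneg)
  have a0: "a \<ge> 0" "b \<ge> 0" by (simp_all add: a_def b_def)
  consider "a = 0" | "b = 0" | "a > 0" "b > 0" using a0 by linarith
  then show ?thesis
  proof cases
    case 1
    then have "\<forall>i\<in>A. f i = 0" using ar r A by (simp add: sum_nonneg_eq_0_iff)
    then show ?thesis by simp
  next
    case 2
    then have "\<forall>i\<in>A. g i = 0" using br r A by (simp add: sum_nonneg_eq_0_iff)
    then show ?thesis by simp
  next
    case 3
    define t where "t = a / (a + b)"
    have t: "0 \<le> t" "t \<le> 1" "1 - t = b / (a + b)" using 3 by (auto simp: t_def field_simps)
    have "norm (f i + g i) powr r \<le>
        (a + b) powr r * (t * (norm (f i) powr r / a powr r) + (1 - t) * (norm (g i) powr r / b powr r))" for i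
    proof -
      have "norm (f i + g i) powr r \<le> (norm (f i) + norm (g i)) powr r"
        using r by (intro powr_mono2 norm_triangle_ineq) auto
      also have "norm (f i) + norm (g i) = (a + b) * (t * (norm (f i) / a) + (1 - t) * (norm (g i) / b))"
        unfolding t(3) unfolding t_def using 3 by (simp add: distrib_left)
      also have "\<dots> powr r = (a + b) powr r * (t * (norm (f i) / a) + (1 - t) * (norm (g i) / b)) powr r"
        by (rule powr_mult)
      also have "\<dots> \<le> (a + b) powr r * (t * (norm (f i) / a) powr r + (1 - t) * (norm (g i) / b) powr r)"
        using 3 t r by (intro mult_left_mono powr_convex_nonneg) auto
      finally show ?thesis using 3 by (simp add: powr_divide)
    qed
    then have "(\<Sum>i\<in>A. norm (f i + g i) powr r) \<le> (\<Sum>i\<in>A.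
        (a + b) powr r * (t * (norm (f i) powr r / a powr r) + (1 - t) * (norm (g i) powr r / b powr r)))"
      by (intro sum_mono)
    also have "\<dots> = (a + b) powr r * (t * (a powr r / a powr r) + (1 - t) * (b powr r / b powr r))"
      by (simp add: sum_distrib_left[symmetric] sum.distrib sum_divide_distrib[symmetric] ar br del: times_divide_eq_right)
    also have "\<dots> = (a + b) powr r" using 3 by simp
    finally have "(\<Sum>i\<in>A. norm (f i + g i) powr r) powr (1 / r) \<le> ((a + b) powr r) powr (1 / r)"
      using r by (intro powr_mono2) (auto intro: sum_nonneg)
    also have "\<dots> = a + b" using 3 r by (simp add: powr_powr)
    finally show ?thesis unfolding a_def b_def .
  qed
qed

text \<open>The induction step is the triangle inequality in the plane with the \<open>\<ell>\<^sup>r\<close> norm, for one vector on each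
  coordinate axis.\<close>

lemma root_of_sum_le:
  fixes a :: "'i \<Rightarrow> real"
  assumes r: "1 \<le> r" and "finite A" and a: "\<And>i. 0 \<le> a i"
  shows "(\<Sum>i\<in>A. a i) powr (1 / r) \<le> (\<Sum>i\<in>A. a i powr (1 / r))"
  using assms(2)
proof (induction rule: finite_induct)
  case (insert j A)
  let ?f = "\<lambda>i. if i = 0 then a j powr (1 / r) else 0"
  let ?g = "\<lambda>i. if i = 0 then 0 else sum a A powr (1 / r)"
  have "(a j + sum a A) powr (1 / r) = (\<Sum>i\<in>{0::nat, 1}. norm (?f i + ?g i) powr r) powr (1 / r)"
    using r a by (simp add: powr_powr sum_nonneg)
  also have "\<dots> \<le> a j powr (1 / r) + sum a A powr (1 / r)"
    using minkowski_sum[OF r, of "{0::nat, 1}" ?f ?g] r a by (simp add: powr_powr sum_nonneg)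
  finally show ?case using insert by simp
qed simp

lemma partial_norm_triangle:
  "1 \<le> r \<Longrightarrow> partial_norm r (x + y) M N \<le> partial_norm r x M N + partial_norm r y M N"
  by (simp add: partial_norm_def flip: sum.distrib) (intro sum_mono minkowski_sum, auto)

lemma partial_norm_mono:
  assumes "0 < r" "\<And>m n. cmod (y m n) \<le> K * cmod (x m n)" "0 \<le> K"
  shows "partial_norm r y M N \<le> K * partial_norm r x M N"
proof -
  have "(\<Sum>n<N. cmod (y m n) powr r) powr (1 / r) \<le> K * (\<Sum>n<N. cmod (x m n) powr r) powr (1 / r)" for m
  proof -
    have "(\<Sum>n<N. cmod (y m n) powr r) \<le> (\<Sum>n<N. K powr r * cmod (x m n) powr r)"
      using assms by (intro sum_mono) (auto simp flip: powr_mult intro!: powr_mono2)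
    also have "\<dots> = K powr r * (\<Sum>n<N. cmod (x m n) powr r)" by (simp add: sum_distrib_left)
    finally have "(\<Sum>n<N. cmod (y m n) powr r) powr (1 / r) \<le> (K powr r * (\<Sum>n<N. cmod (x m n) powr r)) powr (1 / r)"
      using assms by (intro powr_mono2) (auto intro: sum_nonneg)
    then show ?thesis using assms by (simp add: powr_mult powr_powr sum_nonneg)
  qed
  then show ?thesis by (simp add: partial_norm_def sum_distrib_left sum_mono)
qed

lemma coord_le_row:
  fixes x :: "nat \<Rightarrow> nat \<Rightarrow> complex"
  assumes "0 < r" "n < N"
  shows "cmod (x m n) \<le> (\<Sum>n<N. cmod (x m n) powr r) powr (1 / r)"
proof -
  have "cmod (x m n) = (cmod (x m n) powr r) powr (1 / r)" using assms by (simp add: powr_powr)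
  also have "\<dots> \<le> (\<Sum>n<N. cmod (x m n) powr r) powr (1 / r)"
    using assms by (intro powr_mono2 member_le_sum) auto
  finally show ?thesis .
qed

lemma coord_le_partial_norm:
  assumes "0 < r" "m < M" "n < N"
  shows "cmod (x m n) \<le> partial_norm r x M N"
proof -
  have "cmod (x m n) \<le> (\<Sum>n<N. cmod (x m n) powr r) powr (1 / r)"
    by (rule coord_le_row[OF assms(1,3)])
  also have "\<dots> \<le> partial_norm r x M N" unfolding partial_norm_def
    using assms by (intro member_le_sum[of m _ "\<lambda>m. (\<Sum>n<N. cmod (x m n) powr r) powr (1 / r)"]) auto
  finally show ?thesis .
qed

lemma partial_norm_tendsto:
  assumes "0 < r" "\<And>m n. (\<lambda>k::nat. y k m n) \<longlonglongrightarrow> x m n"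
  shows "(\<lambda>k. partial_norm r (y k) M N) \<longlonglongrightarrow> partial_norm r x M N"
  unfolding partial_norm_def
  using assms by (intro tendsto_sum tendsto_powr' tendsto_norm tendsto_const disjI2) (auto intro!: always_eventually sum_nonneg)

text \<open>By monotone convergence in both indices the norm is the supremum of its finite partial sums.
  Membership and a norm bound become one statement about finite sums, in which limits
  of coordinates can be taken; completeness rests on this form of Fatou's lemma.\<close>

lemma l1_lr_norm_le_iff:
  assumes r: "0 < r"
  shows "x \<in> carr (l1_lr r) \<and> nrm (l1_lr r) x \<le> B \<longleftrightarrow> (\<forall>M N. partial_norm r x M N \<le> B)"
    (is "?L \<longleftrightarrow> ?R")
proof
  assume L: ?L
  then have s1: "summable (\<lambda>n. cmod (x m n) powr r)"
    and s2: "summable (\<lambda>m. (\<Sum>n. cmod (x m n) powr r) powr (1 / r))"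
    and le: "(\<Sum>m. (\<Sum>n. cmod (x m n) powr r) powr (1 / r)) \<le> B" for m by (auto simp: l1_lr_def)
  show ?R
  proof (intro allI)
    fix M N
    have "partial_norm r x M N \<le> (\<Sum>m<M. (\<Sum>n. cmod (x m n) powr r) powr (1 / r))"
      unfolding partial_norm_def using r s1 by (intro sum_mono powr_mono2 sum_le_suminf sum_nonneg) auto
    also have "\<dots> \<le> (\<Sum>m. (\<Sum>n. cmod (x m n) powr r) powr (1 / r))"
      using s2 by (intro sum_le_suminf) auto
    finally show "partial_norm r x M N \<le> B" using le by linarith
  qed
next
  assume R: ?R
  have s1: "summable (\<lambda>n. cmod (x m n) powr r)" for m
  proof (rule summableI_nonneg_bounded[where x = "B powr r"])
    fix N
    have "(\<Sum>n<N. cmod (x m n) powr r) powr (1 / r) \<le> partial_norm r x (Suc m) N"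
      unfolding partial_norm_def
      by (intro member_le_sum[of m _ "\<lambda>m. (\<Sum>n<N. cmod (x m n) powr r) powr (1 / r)"]) auto
    also have "\<dots> \<le> B" using R by blast
    finally have "((\<Sum>n<N. cmod (x m n) powr r) powr (1 / r)) powr r \<le> B powr r"
      using r by (intro powr_mono2) auto
    then show "(\<Sum>n<N. cmod (x m n) powr r) \<le> B powr r" using r by (simp add: powr_powr sum_nonneg)
  qed auto
  have "(\<lambda>N. \<Sum>n<N. cmod (x m n) powr r) \<longlonglongrightarrow> (\<Sum>n. cmod (x m n) powr r)" for m
    using s1 by (rule summable_LIMSEQ)
  then have "(\<lambda>N. partial_norm r x M N) \<longlonglongrightarrow> (\<Sum>m<M. (\<Sum>n. cmod (x m n) powr r) powr (1 / r))" for M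
    unfolding partial_norm_def using r
    by (intro tendsto_sum tendsto_powr' tendsto_const disjI2) (auto intro!: always_eventually sum_nonneg)
  then have le: "(\<Sum>m<M. (\<Sum>n. cmod (x m n) powr r) powr (1 / r)) \<le> B" for M
    using R by (metis LIMSEQ_le_const2)
  then have s2: "summable (\<lambda>m. (\<Sum>n. cmod (x m n) powr r) powr (1 / r))"
    by (intro summableI_nonneg_bounded) auto
  have "(\<Sum>m. (\<Sum>n. cmod (x m n) powr r) powr (1 / r)) \<le> B"
    using s2 le by (rule suminf_le_const)
  then show ?L using s1 s2 by (auto simp: l1_lr_def)
qed

lemmas l1_lrI = l1_lr_norm_le_iff[THEN iffD2, rule_format]

lemma partial_norm_le_nrm:
  "0 < r \<Longrightarrow> x \<in> carr (l1_lr r) \<Longrightarrow> partial_norm r x M N \<le> nrm (l1_lr r) x"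
  using l1_lr_norm_le_iff by blast

lemma coord_le_nrm:
  assumes "0 < r" "x \<in> carr (l1_lr r)"
  shows "cmod (x m n) \<le> nrm (l1_lr r) x"
  using coord_le_partial_norm[of r m "Suc m" n "Suc n" x] partial_norm_le_nrm[OF assms, of "Suc m" "Suc n"] assms
  by auto

lemma nrm_nonneg: "0 < r \<Longrightarrow> x \<in> carr (l1_lr r) \<Longrightarrow> 0 \<le> nrm (l1_lr r) x"
  by (rule order_trans[OF norm_ge_zero coord_le_nrm[of r x 0 0]])

lemma l1_lr_dominated:
  assumes r: "0 < r" and x: "x \<in> carr (l1_lr r)"
    and le: "\<And>m n. cmod (y m n) \<le> K * cmod (x m n)" and K: "0 \<le> K"
  shows "y \<in> carr (l1_lr r)" "nrm (l1_lr r) y \<le> K * nrm (l1_lr r) x"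
proof -
  have "partial_norm r y M N \<le> K * nrm (l1_lr r) x" for M N
    by (rule order_trans[OF partial_norm_mono[OF r le K] mult_left_mono[OF partial_norm_le_nrm[OF r x] K]])
  from l1_lrI[OF r this] show "y \<in> carr (l1_lr r)" "nrm (l1_lr r) y \<le> K * nrm (l1_lr r) x" by auto
qed

lemma l1_lr_triangle:
  assumes "1 \<le> r" "x \<in> carr (l1_lr r)" "y \<in> carr (l1_lr r)"
  shows "x + y \<in> carr (l1_lr r)" "nrm (l1_lr r) (x + y) \<le> nrm (l1_lr r) x + nrm (l1_lr r) y"
proof -
  have "partial_norm r (x + y) M N \<le> nrm (l1_lr r) x + nrm (l1_lr r) y" for M N
    using partial_norm_triangle[of r x y M N] partial_norm_le_nrm[of r x M N]
      partial_norm_le_nrm[of r y M N] assms by auto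
  from l1_lrI[OF _ this] assms
  show "x + y \<in> carr (l1_lr r)" "nrm (l1_lr r) (x + y) \<le> nrm (l1_lr r) x + nrm (l1_lr r) y" by auto
qed

text \<open>Domination gives one inequality; the other is the same inequality for the inverse scalar.\<close>

lemma l1_lr_scale:
  assumes "0 < r" "x \<in> carr (l1_lr r)"
  shows "(\<lambda>m n. c * x m n) \<in> carr (l1_lr r)"
    "nrm (l1_lr r) (\<lambda>m n. c * x m n) = cmod c * nrm (l1_lr r) x"
proof -
  have up: "(\<lambda>m n. c * y m n) \<in> carr (l1_lr r) \<and> nrm (l1_lr r) (\<lambda>m n. c * y m n) \<le> cmod c * nrm (l1_lr r) y"
    if "y \<in> carr (l1_lr r)" for c y
    using l1_lr_dominated[OF assms(1) that, of "\<lambda>m n. c * y m n" "cmod c"] by (simp add: norm_mult)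
  show m: "(\<lambda>m n. c * x m n) \<in> carr (l1_lr r)" using up assms by blast
  show "nrm (l1_lr r) (\<lambda>m n. c * x m n) = cmod c * nrm (l1_lr r) x"
  proof (cases "c = 0")
    case True
    then show ?thesis using up[OF assms(2), of c] nrm_nonneg[OF assms(1) m] by auto
  next
    case False
    then have "nrm (l1_lr r) x \<le> cmod (1 / c) * nrm (l1_lr r) (\<lambda>m n. c * x m n)"
      using up[OF m, of "1 / c"] by simp
    then show ?thesis using False up[OF assms(2), of c] by (simp add: norm_divide field_simps)
  qed
qed

lemma l1_lr_zero: "0 < r \<Longrightarrow> 0 \<in> carr (l1_lr r) \<and> nrm (l1_lr r) 0 = 0"
  using l1_lrI[of r 0 0] nrm_nonneg[of r 0] by (auto simp: partial_norm_def intro: antisym)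

lemma l1_lr_diff:
  assumes "1 \<le> r" "x \<in> carr (l1_lr r)" "y \<in> carr (l1_lr r)"
  shows "x - y \<in> carr (l1_lr r)"
proof -
  have "- y = (\<lambda>m n. -1 * y m n)" by (auto simp: fun_eq_iff)
  then have "- y \<in> carr (l1_lr r)" using l1_lr_scale(1)[of r y "-1"] assms by auto
  from l1_lr_triangle(1)[OF assms(1,2) this] show ?thesis by simp
qed

lemma l1_lr_nrm_tendsto_coord:
  assumes "0 < r" "\<forall>\<^sub>F w in F. y w \<in> carr (l1_lr r)" "((\<lambda>w. nrm (l1_lr r) (y w)) \<longlongrightarrow> 0) F"
  shows "((\<lambda>w. y w m n) \<longlongrightarrow> 0) F"
  by (rule Lim_null_comparison[OF eventually_mono[OF assms(2)] assms(3)]) (rule coord_le_nrm[OF assms(1)])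

lemma l1_lr_complete:
  assumes r: "1 \<le> r" and s: "range s \<subseteq> carr (l1_lr r)"
    and C: "\<forall>e>0. \<exists>N::nat. \<forall>i\<ge>N. \<forall>j\<ge>N. nrm (l1_lr r) (s i - s j) < e"
  shows "\<exists>x\<in>carr (l1_lr r). (\<lambda>i. nrm (l1_lr r) (s i - x)) \<longlonglongrightarrow> 0"
proof -
  have d: "s i - s j \<in> carr (l1_lr r)" for i j using s r by (intro l1_lr_diff) auto
  have "Cauchy (\<lambda>i. s i m n)" for m n
  proof (rule metric_CauchyI)
    fix e :: real assume "e > 0"
    then obtain N where N: "\<forall>i\<ge>N. \<forall>j\<ge>N. nrm (l1_lr r) (s i - s j) < e" using C by blast
    show "\<exists>M. \<forall>i\<ge>M. \<forall>j\<ge>M. dist (s i m n) (s j m n) < e"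
    proof (intro exI allI impI)
      fix i j assume "N \<le> i" "N \<le> j"
      then show "dist (s i m n) (s j m n) < e"
        using N coord_le_nrm[OF _ d, of i j m n] r by (fastforce simp: dist_norm)
    qed
  qed
  then have "\<exists>l. (\<lambda>i. s i m n) \<longlonglongrightarrow> l" for m n by (simp add: Cauchy_convergent convergentD)
  then obtain x where x: "\<And>m n. (\<lambda>i. s i m n) \<longlonglongrightarrow> x m n" by metis
  \<comment> \<open>The Cauchy estimate bounds the partial sums of \<open>s i - s j\<close>; letting \<open>j\<close> tend to infinity bounds
    those of \<open>s i - x\<close>.\<close>
  have key: "\<exists>N. \<forall>i\<ge>N. s i - x \<in> carr (l1_lr r) \<and> nrm (l1_lr r) (s i - x) \<le> e" if e: "e > 0" for e
  proof -
    obtain N where N: "\<forall>i\<ge>N. \<forall>j\<ge>N. nrm (l1_lr r) (s i - s j) < e" using C e by blast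
    show ?thesis
    proof (intro exI allI impI l1_lrI)
      fix i M N' assume i: "N \<le> i"
      have "(\<lambda>j. partial_norm r (s i - s j) M N') \<longlonglongrightarrow> partial_norm r (s i - x) M N'"
        using r by (intro partial_norm_tendsto) (auto intro: tendsto_diff x)
      then show "partial_norm r (s i - x) M N' \<le> e"
      proof (rule LIMSEQ_le_const2, intro exI allI impI)
        fix j assume "N \<le> j"
        then show "partial_norm r (s i - s j) M N' \<le> e"
          using N i partial_norm_le_nrm[OF _ d, of i j M N'] r by fastforce
      qed
    qed (use r in auto)
  qed
  obtain N1 where "\<forall>i\<ge>N1. s i - x \<in> carr (l1_lr r)" using key[of 1] by auto
  then have "s N1 - (s N1 - x) \<in> carr (l1_lr r)" using s r by (intro l1_lr_diff[of r "s N1" "s N1 - x"]) blast+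
  then have xc: "x \<in> carr (l1_lr r)" by simp
  have "(\<lambda>i. nrm (l1_lr r) (s i - x)) \<longlonglongrightarrow> 0"
  proof (rule LIMSEQ_I)
    fix e :: real assume "e > 0"
    then obtain N where "\<forall>i\<ge>N. s i - x \<in> carr (l1_lr r) \<and> nrm (l1_lr r) (s i - x) \<le> e / 2"
      using key[of "e/2"] by auto
    then show "\<exists>N. \<forall>i\<ge>N. norm (nrm (l1_lr r) (s i - x) - 0) < e"
      using nrm_nonneg r \<open>e > 0\<close> by (intro exI[of _ N]) (fastforce simp: abs_of_nonneg)
  qed
  then show ?thesis using xc by blast
qed

lemma scl_l1_lr: "scl (l1_lr r) c x = (\<lambda>m n. c * x m n)"
  by (simp add: l1_lr_def)

lemma vector_space_l1_lr: "vector_space (scl (l1_lr r))"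
  by unfold_locales (auto simp: scl_l1_lr fun_eq_iff algebra_simps)

lemma complex_banach_l1_lr:
  assumes r: "1 \<le> r"
  shows "complex_banach (l1_lr r)"
proof -
  have m: "module (scl (l1_lr r))"
    using vector_space_l1_lr by (simp add: module_iff_vector_space)
  have z: "x = 0" if "x \<in> carr (l1_lr r)" "nrm (l1_lr r) x = 0" for x
  proof (intro ext)
    show "x m n = 0 m n" for m n using coord_le_nrm[OF _ that(1), of m n] that r by simp
  qed
  show ?thesis unfolding complex_banach_def module.subspace_def[OF m]
    using r z l1_lr_zero[of r] l1_lr_complete[OF r] nrm_nonneg[of r] l1_lr_triangle[OF r] l1_lr_scale[of r]
      vector_space_l1_lr[of r] by (auto simp: scl_l1_lr)
qed

text \<open>Tannery's theorem, first for the inner sums and then for the outer one.\<close>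

lemma l1_lr_dominated_convergence:
  assumes r: "0 < r" and x: "x \<in> carr (l1_lr r)" and K: "0 \<le> K"
    and lim: "\<And>m n. ((\<lambda>w. y w m n) \<longlongrightarrow> 0) F"
    and le: "\<forall>\<^sub>F w in F. \<forall>m n. cmod (y w m n) \<le> K * cmod (x m n)"
  shows "((\<lambda>w. nrm (l1_lr r) (y w)) \<longlongrightarrow> 0) F"
proof (cases "F = bot")
  case F: False
  define b where "b = (\<lambda>m n. (K * cmod (x m n)) powr r)"
  have "(\<lambda>m n. complex_of_real (K * cmod (x m n))) \<in> carr (l1_lr r)"
    using K by (intro l1_lr_dominated(1)[OF r x _ K]) (simp add: norm_mult)
  then have s1: "summable (b m)" and s2: "summable (\<lambda>m. (\<Sum>n. b m n) powr (1 / r))" for m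
    using K by (simp_all add: l1_lr_def b_def norm_mult)
  have dom: "\<forall>\<^sub>F w in F. \<forall>m n. cmod (y w m n) powr r \<le> b m n"
    using le by eventually_elim (use r in \<open>auto simp: b_def intro!: powr_mono2\<close>)
  have inner: "((\<lambda>w. \<Sum>n. cmod (y w m n) powr r) \<longlongrightarrow> (\<Sum>n::nat. 0)) F" for m
  proof (rule tannerys_theorem[THEN conjunct2, THEN conjunct2])
    show "((\<lambda>w. cmod (y w m n) powr r) \<longlongrightarrow> 0) F" for n
      using tendsto_powr'[OF tendsto_norm_zero[OF lim[of m n]] tendsto_const[of r]] r by auto
    show "\<forall>\<^sub>F (n, w) in at_top \<times>\<^sub>F F. norm (cmod (y w m n) powr r) \<le> b m n"
      by (rule eventually_mono[OF eventually_prodI[OF eventually_True dom]]) auto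
  qed (use s1 F in auto)
  have summ: "\<forall>\<^sub>F w in F. \<forall>m. summable (\<lambda>n. cmod (y w m n) powr r)"
    using dom
  proof eventually_elim
    case (elim w)
    show ?case by (intro allI summable_comparison_test'[OF s1, of 0]) (use elim in auto)
  qed
  have "((\<lambda>w. \<Sum>m. (\<Sum>n. cmod (y w m n) powr r) powr (1 / r)) \<longlongrightarrow> (\<Sum>m::nat. 0)) F"
  proof (rule tannerys_theorem[THEN conjunct2, THEN conjunct2])
    show "((\<lambda>w. (\<Sum>n. cmod (y w m n) powr r) powr (1 / r)) \<longlongrightarrow> 0) F" for m
    proof -
      have "\<forall>\<^sub>F w in F. 0 \<le> (\<Sum>n. cmod (y w m n) powr r)"
        using summ by eventually_elim (auto intro: suminf_nonneg)
      then show ?thesis using tendsto_powr'[OF inner[of m] tendsto_const[of "1 / r"]] r by auto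
    qed
    have "\<forall>\<^sub>F w in F. \<forall>m. norm ((\<Sum>n. cmod (y w m n) powr r) powr (1 / r)) \<le> (\<Sum>n. b m n) powr (1 / r)"
      using summ dom by eventually_elim (use r s1 in \<open>auto intro!: powr_mono2 suminf_le suminf_nonneg\<close>)
    then show "\<forall>\<^sub>F (m, w) in at_top \<times>\<^sub>F F. norm ((\<Sum>n. cmod (y w m n) powr r) powr (1 / r))
        \<le> (\<Sum>n. b m n) powr (1 / r)"
      by (rule eventually_mono[OF eventually_prodI[OF eventually_True]]) auto
  qed (use s2 F in auto)
  then show ?thesis by (simp add: l1_lr_def)
qed simp

section \<open>The diagonal operator and its semigroup\<close>

definition diag_mult :: "(nat \<Rightarrow> complex) \<Rightarrow> (nat \<Rightarrow> nat \<Rightarrow> complex) \<Rightarrow> nat \<Rightarrow> nat \<Rightarrow> complex" where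
  "diag_mult c x = (\<lambda>m n. c n * x m n)"

definition entry :: "nat \<Rightarrow> real" where "entry n = 2 ^ Suc n"

lemma entry_pos [simp]: "0 < entry n" "0 \<le> entry n" "entry n \<noteq> 0" by (simp_all add: entry_def)

lemma diag_op_eq_diag_mult: "diag_op = diag_mult (\<lambda>n. complex_of_real (entry n))"
  by (simp add: fun_eq_iff diag_op_def diag_mult_def entry_def)

lemma diag_mult_bounded:
  assumes "0 < r" "x \<in> carr (l1_lr r)" "\<And>n. cmod (c n) \<le> K"
  shows "diag_mult c x \<in> carr (l1_lr r)" "nrm (l1_lr r) (diag_mult c x) \<le> K * nrm (l1_lr r) x"
proof -
  have "0 \<le> K" using norm_ge_zero assms(3) by (rule order_trans)
  then show "diag_mult c x \<in> carr (l1_lr r)" "nrm (l1_lr r) (diag_mult c x) \<le> K * nrm (l1_lr r) x"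
    using l1_lr_dominated[of r x "diag_mult c x" K] assms
    by (auto simp: diag_mult_def norm_mult mult_right_mono)
qed

lemma diag_mult_linear:
  "diag_mult c (x + y) = diag_mult c x + diag_mult c y"
  "diag_mult c (scl (l1_lr r) a x) = scl (l1_lr r) a (diag_mult c x)"
  by (simp_all add: diag_mult_def scl_l1_lr fun_eq_iff algebra_simps)

lemma bounded_op_diag_mult:
  assumes "0 < r" "\<And>n. cmod (c n) \<le> K"
  shows "bounded_op (l1_lr r) (diag_mult c)"
  unfolding bounded_op_def using diag_mult_bounded[OF assms(1), of _ c K] assms(2) diag_mult_linear by blast

text \<open>The form of dominated convergence used for strong limits of multipliers: pointwise
  convergence and a uniform bound suffice.\<close>

lemma diag_mult_tendsto_zero:
  assumes "0 < r" "x \<in> carr (l1_lr r)" "\<And>n. ((\<lambda>w. c w n) \<longlongrightarrow> 0) F"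
    and "\<forall>\<^sub>F w in F. \<forall>n. cmod (c w n) \<le> K" "0 \<le> K"
  shows "((\<lambda>w. nrm (l1_lr r) (diag_mult (c w) x)) \<longlongrightarrow> 0) F"
proof (rule l1_lr_dominated_convergence[OF assms(1,2,5)])
  show "((\<lambda>w. diag_mult (c w) x m n) \<longlongrightarrow> 0) F" for m n
    unfolding diag_mult_def by (intro tendsto_mult_left_zero assms)
  show "\<forall>\<^sub>F w in F. \<forall>m n. cmod (diag_mult (c w) x m n) \<le> K * cmod (x m n)"
    using assms(4) by eventually_elim (simp add: diag_mult_def norm_mult mult_right_mono)
qed

lemma subspace_carr: "1 \<le> r \<Longrightarrow> module.subspace (scl (l1_lr r)) (carr (l1_lr r))"
  using complex_banach_l1_lr by (simp add: complex_banach_def)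

text \<open>Truncating all rows at a common length lands in the domain, because the entries of \<open>A\<close> are bounded on
  finitely many columns.\<close>

lemma densely_defined_diag_op:
  assumes r: "1 \<le> r"
  shows "densely_defined (l1_lr r) (diag_dom r) diag_op"
  unfolding densely_defined_def
proof (intro conjI ballI allI impI)
  have m: "module (scl (l1_lr r))"
    using vector_space_l1_lr by (simp add: module_iff_vector_space)
  show "module.subspace (scl (l1_lr r)) (diag_dom r)"
    using subspace_carr[OF r] unfolding module.subspace_def[OF m] diag_dom_def diag_op_eq_diag_mult
    by (auto simp: diag_mult_linear) (simp add: diag_mult_def zero_fun_def)
  fix x and e :: real assume x: "x \<in> carr (l1_lr r)" and e: "0 < e"
  define t where "t = (\<lambda>(N::nat) n. if n < N then 1 else 0 :: complex)"
  have tr: "diag_mult (t N) x \<in> diag_dom r" for N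
  proof -
    have "cmod (complex_of_real (entry n) * t N n) \<le> entry N" for n
      by (auto simp: t_def entry_def norm_mult norm_power)
    then have "diag_mult (\<lambda>n. complex_of_real (entry n) * t N n) x \<in> carr (l1_lr r)"
      using r by (intro diag_mult_bounded(1)[OF _ x]) auto
    moreover have "diag_mult (t N) x \<in> carr (l1_lr r)"
      using r by (intro diag_mult_bounded(1)[OF _ x, of _ 1]) (auto simp: t_def)
    ultimately show ?thesis by (simp add: diag_dom_def diag_op_eq_diag_mult diag_mult_def mult.assoc)
  qed
  have "(\<lambda>N. nrm (l1_lr r) (diag_mult (\<lambda>n. 1 - t N n) x)) \<longlonglongrightarrow> 0"
  proof (rule diag_mult_tendsto_zero[OF _ x, of _ _ 1])
    show "(\<lambda>N. 1 - t N n) \<longlonglongrightarrow> 0" for n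
      by (rule tendsto_eventually) (auto simp: t_def intro: eventually_mono[OF eventually_gt_at_top[of n]])
  qed (use r in \<open>auto simp: t_def\<close>)
  moreover have "diag_mult (\<lambda>n. 1 - t N n) x = x - diag_mult (t N) x" for N
    by (simp add: diag_mult_def fun_eq_iff algebra_simps)
  ultimately have "(\<lambda>N. nrm (l1_lr r) (x - diag_mult (t N) x)) \<longlonglongrightarrow> 0" by simp
  from order_tendstoD(2)[OF this e] obtain N where "nrm (l1_lr r) (x - diag_mult (t N) x) < e"
    by (auto simp: eventually_sequentially)
  then show "\<exists>y\<in>diag_dom r. nrm (l1_lr r) (x - y) < e" using tr by blast
qed (auto simp: diag_dom_def diag_op_eq_diag_mult diag_mult_linear)

text \<open>The angle \<open>\<pi>/2\<close> works with constant \<open>1\<close>: a point \<open>z\<close> in the open left half-plane is at least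
  as far from the positive number \<open>a\<^sub>n\<close> as from \<open>0\<close>, so \<open>z / (z - a\<^sub>n)\<close> has modulus at most \<open>1\<close>.
  Likewise \<open>a\<^sub>n / (z - a\<^sub>n)\<close> is bounded, which puts the range of the resolvent into the domain.\<close>

lemma sectorial_diag_op:
  assumes r: "1 \<le> r"
  shows "sectorial (l1_lr r) (diag_dom r) diag_op"
proof -
  have "\<exists>R. bounded_op (l1_lr r) R \<and>
      (\<forall>x\<in>carr (l1_lr r). R x \<in> diag_dom r \<and> scl (l1_lr r) z (R x) - diag_op (R x) = x) \<and>
      (\<forall>x\<in>diag_dom r. R (scl (l1_lr r) z x - diag_op x) = x) \<and>
      (\<forall>x\<in>carr (l1_lr r). nrm (l1_lr r) (scl (l1_lr r) z (R x)) \<le> 1 * nrm (l1_lr r) x)"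
    if z: "z \<noteq> 0" "pi / 2 < \<bar>Arg z\<bar>" for z
  proof -
    have Re: "Re z < 0" using Arg_Re_nonneg[of z] z by linarith
    define a where "a = (\<lambda>n. complex_of_real (entry n))"
    have ne: "z - a n \<noteq> 0" for n
    proof -
      have "Re (z - a n) < 0" using Re entry_pos(1)[of n] unfolding a_def minus_complex.sel Re_complex_of_real by linarith
      then show ?thesis by auto
    qed
    have za: "cmod z \<le> cmod (z - a n)" and aa: "cmod (a n) \<le> cmod (z - a n)" for n
    proof -
      have "Re z * entry n \<le> 0" using Re by (simp add: mult_nonpos_nonneg)
      then have "(Re z)\<^sup>2 \<le> (Re z - entry n)\<^sup>2"
        using zero_le_power2[of "entry n"] unfolding power2_diff by linarith
      then show "cmod z \<le> cmod (z - a n)" by (simp add: cmod_def a_def)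
      show "cmod (a n) \<le> cmod (z - a n)"
        using abs_Re_le_cmod[of "z - a n"] Re entry_pos(1)[of n] by (simp add: a_def)
    qed
    define R where "R = diag_mult (\<lambda>n. 1 / (z - a n))"
    have zR: "scl (l1_lr r) z (R x) = diag_mult (\<lambda>n. z / (z - a n)) x"
      and aR: "diag_op (R x) = diag_mult (\<lambda>n. a n / (z - a n)) x" for x
      by (simp_all add: R_def scl_l1_lr diag_op_eq_diag_mult diag_mult_def a_def)
    have b: "cmod (1 / (z - a n)) \<le> 1 / cmod z" for n
      using za[of n] z by (simp add: norm_divide frac_le)
    have b1: "cmod (z / (z - a n)) \<le> 1" "cmod (a n / (z - a n)) \<le> 1" for n
      using za[of n] aa[of n] ne[of n] by (simp_all add: norm_divide)
    have r0: "0 < r" using r by simp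
    show ?thesis
    proof (intro exI[of _ R] conjI ballI)
      show "bounded_op (l1_lr r) R" unfolding R_def by (rule bounded_op_diag_mult[OF r0 b])
    next
      fix x assume x: "x \<in> carr (l1_lr r)"
      have "R x \<in> carr (l1_lr r)" unfolding R_def by (rule diag_mult_bounded(1)[OF r0 x b])
      moreover have "diag_op (R x) \<in> carr (l1_lr r)" unfolding aR by (rule diag_mult_bounded(1)[OF r0 x b1(2)])
      ultimately show "R x \<in> diag_dom r" by (simp add: diag_dom_def)
      show "scl (l1_lr r) z (R x) - diag_op (R x) = x"
        unfolding zR aR using ne by (simp add: diag_mult_def fun_eq_iff flip: left_diff_distrib diff_divide_distrib)
      show "nrm (l1_lr r) (scl (l1_lr r) z (R x)) \<le> 1 * nrm (l1_lr r) x"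
        unfolding zR by (rule diag_mult_bounded(2)[OF r0 x b1(1)])
    next
      fix x
      show "R (scl (l1_lr r) z x - diag_op x) = x"
        using ne by (simp add: R_def scl_l1_lr diag_op_eq_diag_mult diag_mult_def fun_eq_iff a_def flip: left_diff_distrib)
    qed
  qed
  then show ?thesis unfolding sectorial_def
    by (intro bexI[of _ "pi / 2"] exI[of _ 1]) auto
qed

text \<open>The semigroup at complex times, so that the analytic extension needs no separate definition.\<close>

definition diag_exp :: "complex \<Rightarrow> (nat \<Rightarrow> nat \<Rightarrow> complex) \<Rightarrow> nat \<Rightarrow> nat \<Rightarrow> complex" where
  "diag_exp z = diag_mult (\<lambda>n. exp (- complex_of_real (entry n) * z))"

lemma norm_exp_entry_le_1: "0 \<le> Re z \<Longrightarrow> cmod (exp (- complex_of_real (entry n) * z)) \<le> 1"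
  by simp

lemma diag_exp_add: "diag_exp (z + w) x = diag_exp z (diag_exp w x)"
  by (simp add: diag_exp_def diag_mult_def fun_eq_iff exp_add algebra_simps flip: exp_diff exp_add)

lemma bounded_op_diag_exp: "0 < r \<Longrightarrow> 0 \<le> Re z \<Longrightarrow> bounded_op (l1_lr r) (diag_exp z)"
  unfolding diag_exp_def by (rule bounded_op_diag_mult[OF _ norm_exp_entry_le_1])

lemma diag_exp_tendsto:
  assumes r: "0 < r" and x: "x \<in> carr (l1_lr r)" and F: "(g \<longlongrightarrow> 0) F" "\<forall>\<^sub>F w in F. 0 \<le> Re (g w)"
  shows "((\<lambda>w. nrm (l1_lr r) (diag_exp (g w) x - x)) \<longlongrightarrow> 0) F"
proof -
  have "((\<lambda>w. nrm (l1_lr r) (diag_mult (\<lambda>n. exp (- complex_of_real (entry n) * g w) - 1) x)) \<longlongrightarrow> 0) F"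
  proof (rule diag_mult_tendsto_zero[OF r x, of _ _ 2])
    show "((\<lambda>w. exp (- complex_of_real (entry n) * g w) - 1) \<longlongrightarrow> 0) F" for n
      using F(1) by (auto intro!: tendsto_eq_intros)
    show "\<forall>\<^sub>F w in F. \<forall>n. cmod (exp (- complex_of_real (entry n) * g w) - 1) \<le> 2"
      using F(2)
    proof eventually_elim
      case (elim w)
      show ?case
      proof
        fix n
        show "cmod (exp (- complex_of_real (entry n) * g w) - 1) \<le> 2"
          using norm_triangle_ineq4[of "exp (- complex_of_real (entry n) * g w)" 1] norm_exp_entry_le_1[OF elim, of n] 
          by (smt (verit) norm_one)
      qed
    qed
  qed simp
  then show ?thesis by (simp add: diag_exp_def diag_mult_def fun_diff_def algebra_simps)
qed

lemma C0_semigroup_diag_exp: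
  assumes r: "0 < r"
  shows "C0_semigroup (l1_lr r) (\<lambda>t. diag_exp (complex_of_real t))"
  unfolding C0_semigroup_def
proof (intro conjI allI ballI impI)
  fix x assume x: "x \<in> carr (l1_lr r)"
  show "((\<lambda>t. nrm (l1_lr r) (diag_exp (complex_of_real t) x - x)) \<longlongrightarrow> 0) (at_right 0)"
  proof (rule diag_exp_tendsto[OF r x])
    show "(complex_of_real \<longlongrightarrow> 0) (at_right 0)"
      using tendsto_of_real[OF tendsto_ident_at[of 0 "{0<..}"]] by simp
    show "\<forall>\<^sub>F t in at_right 0. 0 \<le> Re (complex_of_real t)"
      by (rule eventually_at_rightI[of 0 1]) auto
  qed
qed (use r in \<open>auto simp: bounded_op_diag_exp diag_exp_add\<close>, simp add: diag_exp_def diag_mult_def)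

text \<open>The Lipschitz constant does not depend on \<open>n\<close>, because \<open>a e\<^sup>-\<^sup>a\<^sup>c \<le> 1 / c\<close> for every \<open>a > 0\<close>. This is the
  uniform bound behind analyticity.\<close>

lemma exp_entry_lipschitz:
  assumes c: "0 < c" "c < Re w" "c < Re z"
  shows "cmod (exp (- complex_of_real (entry n) * w) - exp (- complex_of_real (entry n) * z)) \<le> 1 / c * cmod (w - z)"
proof (rule field_differentiable_bound[of "{w. c < Re w}"])
  fix w assume "w \<in> {w. c < Re w}"
  then have w: "c < Re w" by simp
  show "((\<lambda>w. exp (- complex_of_real (entry n) * w)) has_field_derivative
      - complex_of_real (entry n) * exp (- complex_of_real (entry n) * w)) (at w within {w. c < Re w})"
    by (auto intro!: derivative_eq_intros)
  have "entry n * c \<le> exp (entry n * c)" using exp_ge_add_one_self[of "entry n * c"] by linarith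
  then have "entry n * exp (- (entry n * c)) \<le> 1 / c"
    using c by (simp add: exp_minus field_simps)
  moreover have "entry n * exp (- (entry n * Re w)) \<le> entry n * exp (- (entry n * c))"
    using w by (simp add: less_imp_le)
  ultimately have "entry n * exp (- (entry n * Re w)) \<le> 1 / c" by (rule order_trans[rotated])
  then show "cmod (- complex_of_real (entry n) * exp (- complex_of_real (entry n) * w)) \<le> 1 / c"
    by (simp add: norm_mult)
qed (use assms convex_halfspace_Re_gt in auto)

text \<open>The difference quotients of the scalar exponentials converge for each \<open>n\<close>, and are bounded
  uniformly in \<open>n\<close> near \<open>z\<close> by the Lipschitz estimate.\<close>

lemma diag_exp_differentiable:
  assumes r: "0 < r" and x: "x \<in> carr (l1_lr r)" and z: "0 < Re z"
  shows "\<exists>y\<in>carr (l1_lr r).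
    ((\<lambda>w. nrm (l1_lr r) (scl (l1_lr r) (1 / (w - z)) (diag_exp w x - diag_exp z x) - y)) \<longlongrightarrow> 0) (at z)"
proof -
  define c where "c = Re z / 2"
  have c: "0 < c" "c < Re z" using z by (simp_all add: c_def)
  define d where "d = (\<lambda>n. - complex_of_real (entry n) * exp (- complex_of_real (entry n) * z))"
  define q where "q = (\<lambda>w n. (exp (- complex_of_real (entry n) * w) - exp (- complex_of_real (entry n) * z)) / (w - z))"
  have "((\<lambda>w. exp (- complex_of_real (entry n) * w)) has_field_derivative d n) (at z)" for n
    unfolding d_def by (auto intro!: derivative_eq_intros)
  then have lim: "((\<lambda>w. q w n) \<longlongrightarrow> d n) (at z)" for n
    by (simp add: has_field_derivative_iff q_def)
  have "open {w. c < Re w}" by (rule open_halfspace_Re_gt)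
  then have near: "\<forall>\<^sub>F w in at z. c < Re w"
    using eventually_at_in_open'[of "{w. c < Re w}" z] c by simp
  have q: "cmod (q w n) \<le> 1 / c" if "c < Re w" for w n
  proof (cases "w = z")
    case False
    then have "0 < cmod (w - z)" by simp
    then show ?thesis using exp_entry_lipschitz[OF c(1) that c(2), of n]
      unfolding q_def norm_divide by (subst pos_divide_le_eq)
  qed (use c in \<open>simp add: q_def\<close>)
  have d: "cmod (d n) \<le> 1 / c" for n
    by (rule tendsto_upperbound[OF tendsto_norm[OF lim]]) (use near q in \<open>auto elim: eventually_mono\<close>)
  have "((\<lambda>w. nrm (l1_lr r) (diag_mult (\<lambda>n. q w n - d n) x)) \<longlongrightarrow> 0) (at z)"
  proof (rule diag_mult_tendsto_zero[OF r x, of _ _ "1 / c + 1 / c"])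
    show "((\<lambda>w. q w n - d n) \<longlongrightarrow> 0) (at z)" for n using lim[of n] by (simp add: LIM_zero)
    show "\<forall>\<^sub>F w in at z. \<forall>n. cmod (q w n - d n) \<le> 1 / c + 1 / c"
      using near by eventually_elim (use q d in \<open>blast intro: order_trans[OF norm_triangle_ineq4] add_mono\<close>)
  qed (use c in simp)
  moreover have "scl (l1_lr r) (1 / (w - z)) (diag_exp w x - diag_exp z x) - diag_mult d x
      = diag_mult (\<lambda>n. q w n - d n) x" for w
    by (simp add: scl_l1_lr diag_exp_def diag_mult_def fun_eq_iff q_def left_diff_distrib right_diff_distrib diff_divide_distrib)
  ultimately show ?thesis
    using diag_mult_bounded(1)[OF r x d] by (intro bexI[of _ "diag_mult d x"]) simp_all
qed

lemma analytic_semigroup_diag_exp: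
  assumes r: "0 < r"
  shows "analytic_semigroup (l1_lr r) (\<lambda>t. diag_exp (complex_of_real t))"
proof -
  have Re: "0 < Re z" if "z \<in> sector (pi / 2)" for z
    using that Arg_Re_pos[of z] by (auto simp: sector_def)
  have "((\<lambda>z. nrm (l1_lr r) (diag_exp z x - x)) \<longlongrightarrow> 0) (at 0 within sector \<theta>)"
    if x: "x \<in> carr (l1_lr r)" and t: "\<theta> < pi / 2" for \<theta> x
  proof (rule diag_exp_tendsto[OF r x tendsto_ident_at])
    have "sector \<theta> \<subseteq> sector (pi / 2)" using t by (auto simp: sector_def)
    then show "\<forall>\<^sub>F w in at 0 within sector \<theta>. 0 \<le> Re w"
      unfolding eventually_at_filter using Re by (intro always_eventually) (auto intro: less_imp_le)
  qed
  then show ?thesis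
    unfolding analytic_semigroup_def
    using C0_semigroup_diag_exp[OF r] diag_exp_differentiable[OF r]
      bounded_op_diag_exp[OF r less_imp_le[OF Re]] Re diag_exp_add pi_gt_zero
    by (intro conjI bexI[of _ "pi / 2"] exI[of _ diag_exp]) auto
qed

lemma exp_difference_quotient:
  "((\<lambda>h. (exp (- complex_of_real a * complex_of_real h) - 1) / complex_of_real h + complex_of_real a) \<longlongrightarrow> 0) (at_right 0)"
proof -
  have "((\<lambda>h. exp (- a * h)) has_real_derivative - a) (at 0)"
    by (auto intro!: derivative_eq_intros)
  then have "((\<lambda>h. (exp (- a * h) - 1) / h) \<longlongrightarrow> - a) (at 0)"
    by (simp add: has_field_derivative_iff)
  then have "((\<lambda>h. (exp (- a * h) - 1) / h) \<longlongrightarrow> - a) (at_right 0)"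
    by (rule filterlim_mono) (auto simp: at_within_le_at)
  then have "((\<lambda>h. complex_of_real ((exp (- a * h) - 1) / h + a)) \<longlongrightarrow> complex_of_real (- a + a)) (at_right 0)"
    by (intro tendsto_of_real tendsto_add tendsto_const)
  then show ?thesis by (simp flip: exp_of_real)
qed

text \<open>On the domain the difference quotients differ from \<open>-A x\<close> by at most \<open>2 \<bar>A x\<bar>\<close> in each
  coordinate, so dominated convergence applies. Conversely, norm convergence forces convergence of each coordinate, so the only
  possible limit is \<open>-A x\<close>, which then belongs to the space.\<close>

lemma generator_diag_exp:
  assumes r: "1 \<le> r"
  shows "generator_of (l1_lr r) (\<lambda>t. diag_exp (complex_of_real t)) (diag_dom r) (\<lambda>x. - diag_op x)"
proof -
  have r0: "0 < r" using r by simp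
  define q where "q = (\<lambda>h n. (exp (- complex_of_real (entry n) * complex_of_real h) - 1) / complex_of_real h)"
  have lim: "((\<lambda>h. q h n + complex_of_real (entry n)) \<longlongrightarrow> 0) (at_right 0)" for n
    unfolding q_def by (rule exp_difference_quotient)
  have q: "cmod (q h n + complex_of_real (entry n)) \<le> 2 * entry n" if "0 < h" for h n
  proof -
    have "q h n + complex_of_real (entry n) = complex_of_real ((exp (- entry n * h) - 1) / h + entry n)"
      by (simp add: q_def flip: exp_of_real)
    moreover have "\<bar>(exp (- entry n * h) - 1) / h\<bar> \<le> entry n"
      using that exp_ge_add_one_self[of "- entry n * h"] by (auto simp: field_simps abs_if)
    ultimately show ?thesis using entry_pos(1)[of n] by (simp only: norm_of_real)
  qed
  have eq: "scl (l1_lr r) (complex_of_real (1 / h)) (diag_exp (complex_of_real h) x - x) = diag_mult (q h) x" for h x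
    by (simp add: scl_l1_lr diag_exp_def diag_mult_def fun_eq_iff q_def left_diff_distrib diff_divide_distrib)
  have ran: "diag_op x \<in> carr (l1_lr r)" "x \<in> carr (l1_lr r)" if "x \<in> diag_dom r" for x
    using that by (auto simp: diag_dom_def)
  have neg: "- y \<in> carr (l1_lr r)" if "y \<in> carr (l1_lr r)" for y
    using l1_lr_diff[OF r _ that, of 0] l1_lr_zero[OF r0] by simp
  have "x \<in> diag_dom r \<and> - diag_op x = y \<longleftrightarrow>
      ((\<lambda>h. nrm (l1_lr r) (diag_mult (q h) x - y)) \<longlongrightarrow> 0) (at_right 0)"
    if x: "x \<in> carr (l1_lr r)" and y: "y \<in> carr (l1_lr r)" for x y
  proof
    assume A: "x \<in> diag_dom r \<and> - diag_op x = y"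
    have e: "diag_mult (q h) x - y = diag_mult (\<lambda>n. q h n + complex_of_real (entry n)) x" for h
      by (simp add: conjunct2[OF A, symmetric] diag_op_eq_diag_mult diag_mult_def fun_eq_iff algebra_simps)
    show "((\<lambda>h. nrm (l1_lr r) (diag_mult (q h) x - y)) \<longlongrightarrow> 0) (at_right 0)" unfolding e
    proof (rule l1_lr_dominated_convergence[OF r0 ran(1)[OF conjunct1[OF A]], of 2])
      show "((\<lambda>h. diag_mult (\<lambda>n. q h n + complex_of_real (entry n)) x m n) \<longlongrightarrow> 0) (at_right 0)" for m n
        unfolding diag_mult_def by (intro tendsto_mult_left_zero lim)
      show "\<forall>\<^sub>F h in at_right 0. \<forall>m n. cmod (diag_mult (\<lambda>n. q h n + complex_of_real (entry n)) x m n) \<le> 2 * cmod (diag_op x m n)"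
        using eventually_at_right_less[of "0::real"]
      proof eventually_elim
        case (elim h)
        show ?case
        proof (intro allI)
          fix m n
          show "cmod (diag_mult (\<lambda>n. q h n + complex_of_real (entry n)) x m n) \<le> 2 * cmod (diag_op x m n)"
            using mult_right_mono[OF q[OF elim, of n] norm_ge_zero[of "x m n"]]
            by (simp add: diag_mult_def diag_op_eq_diag_mult norm_mult)
        qed
      qed
    qed simp
  next
    assume L: "((\<lambda>h. nrm (l1_lr r) (diag_mult (q h) x - y)) \<longlongrightarrow> 0) (at_right 0)"
    have c: "\<forall>\<^sub>F h in at_right 0. diag_mult (q h) x - y \<in> carr (l1_lr r)"
      using eventually_at_right_less[of "0::real"]
    proof eventually_elim
      case (elim h)
      then have "diag_exp (complex_of_real h) x \<in> carr (l1_lr r)"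
        using bounded_op_diag_exp[OF r0, of "complex_of_real h"] x by (simp add: bounded_op_def)
      then show ?case unfolding eq[symmetric] scl_l1_lr
        using x y r by (intro l1_lr_diff l1_lr_scale(1)) auto
    qed
    have "y m n = - diag_op x m n" for m n
    proof -
      have "((\<lambda>h. (diag_mult (q h) x - y) m n) \<longlongrightarrow> 0) (at_right 0)"
        by (rule l1_lr_nrm_tendsto_coord[OF r0 c L])
      moreover have "((\<lambda>h. (q h n + complex_of_real (entry n)) * x m n) \<longlongrightarrow> 0) (at_right 0)"
        by (intro tendsto_mult_left_zero lim)
      ultimately have "((\<lambda>h. (q h n + complex_of_real (entry n)) * x m n - (diag_mult (q h) x - y) m n) \<longlongrightarrow> 0 - 0) (at_right 0)"
        by (rule tendsto_diff[rotated])
      then have "((\<lambda>h::real. diag_op x m n + y m n) \<longlongrightarrow> 0) (at_right 0)"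
        by (simp add: diag_mult_def diag_op_eq_diag_mult algebra_simps)
      then have "diag_op x m n + y m n = 0"
        by (simp add: tendsto_const_iff)
      then show ?thesis by (simp add: add_eq_0_iff2)
    qed
    then have "- diag_op x = y" by (simp add: fun_eq_iff)
    moreover from this have "diag_op x \<in> carr (l1_lr r)" using neg[OF y] by auto
    ultimately show "x \<in> diag_dom r \<and> - diag_op x = y" using x by (simp add: diag_dom_def)
  qed
  then show ?thesis unfolding generator_of_def eq using ran neg by blast
qed

section \<open>Bochner integrals of finitely supported functions\<close>

lemma coord_sum: "(\<Sum>i\<in>A. F i) m n = (\<Sum>i\<in>A. F i m n)" for F :: "'i \<Rightarrow> nat \<Rightarrow> nat \<Rightarrow> complex"
  by (induction A rule: infinite_finite_induct) auto

lemma simple_integral_on_coord: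
  assumes s: "simple_integrable_on (l1_lr r) M s"
  shows "Bochner_Integration.simple_bochner_integrable M (\<lambda>x. s x m n)"
    "simple_integral_on (l1_lr r) M s m n = Bochner_Integration.simple_bochner_integral M (\<lambda>x. s x m n)"
proof -
  have sf: "simple_function M s" and fin: "emeasure M {x \<in> space M. s x \<noteq> 0} \<noteq> \<infinity>"
    using s by (auto simp: simple_integrable_on_def)
  show sb: "Bochner_Integration.simple_bochner_integrable M (\<lambda>x. s x m n)"
  proof
    show "simple_function M (\<lambda>x. s x m n)"
      by (rule simple_function_compose1[OF sf])
    have "{x \<in> space M. s x \<noteq> 0} = s -` (- {0}) \<inter> space M" by auto
    then have "{x \<in> space M. s x \<noteq> 0} \<in> sets M" using simple_functionD(2)[OF sf] by simp
    then have "emeasure M {x \<in> space M. s x m n \<noteq> 0} \<le> emeasure M {x \<in> space M. s x \<noteq> 0}"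
      by (intro emeasure_mono) auto
    then show "emeasure M {x \<in> space M. s x m n \<noteq> 0} \<noteq> \<infinity>" using fin by (auto simp: top_unique)
  qed
  show "simple_integral_on (l1_lr r) M s m n = Bochner_Integration.simple_bochner_integral M (\<lambda>x. s x m n)"
    unfolding simple_integral_on_def coord_sum
    by (subst simple_bochner_integral_partition[OF sb sf, of "\<lambda>y. y m n"])
      (auto simp: scl_l1_lr scaleR_conv_of_real)
qed

text \<open>Evaluation at a coordinate is a contraction, so it maps approximating simple functions to approximating
  simple functions. This determines all coordinates of a vector-valued integral, and hence its uniqueness.\<close>

lemma has_bochner_integral_on_coord:
  assumes r: "1 \<le> r" and f: "has_bochner_integral_on (l1_lr r) M f y"
    and meas: "(\<lambda>x. f x m n) \<in> borel_measurable M"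
  shows "has_bochner_integral M (\<lambda>x. f x m n) (y m n)"
proof -
  have r0: "0 < r" using r by simp
  obtain s where s: "\<And>k::nat. simple_integrable_on (l1_lr r) M (s k)"
    and l1: "(\<lambda>k. \<integral>\<^sup>+x. ennreal (nrm (l1_lr r) (f x - s k x)) \<partial>M) \<longlonglongrightarrow> 0"
    and lim: "(\<lambda>k. nrm (l1_lr r) (simple_integral_on (l1_lr r) M (s k) - y)) \<longlonglongrightarrow> 0"
    and fc: "AE x in M. f x \<in> carr (l1_lr r)" and y: "y \<in> carr (l1_lr r)"
    using f by (auto simp: has_bochner_integral_on_def strongly_measurable_def)
  have sc: "s k x \<in> carr (l1_lr r)" if "x \<in> space M" for k x
    using s that by (auto simp: simple_integrable_on_def)
  show ?thesis
  proof (rule has_bochner_integral.intros[OF meas])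
    show "Bochner_Integration.simple_bochner_integrable M (\<lambda>x. s k x m n)" for k
      by (rule simple_integral_on_coord(1)[OF s])
    show "(\<lambda>k. \<integral>\<^sup>+x. norm (f x m n - s k x m n) \<partial>M) \<longlonglongrightarrow> 0"
    proof (rule tendsto_sandwich[OF _ _ tendsto_const l1])
      have "(\<integral>\<^sup>+x. norm (f x m n - s k x m n) \<partial>M) \<le> (\<integral>\<^sup>+x. ennreal (nrm (l1_lr r) (f x - s k x)) \<partial>M)" for k
      proof (rule nn_integral_mono_AE)
        show "AE x in M. ennreal (norm (f x m n - s k x m n)) \<le> ennreal (nrm (l1_lr r) (f x - s k x))"
          using fc AE_space
        proof eventually_elim
          case (elim x)
          then show ?case
            using coord_le_nrm[OF r0 l1_lr_diff[OF r elim(1) sc[OF elim(2)]], of k m n]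
            by (intro ennreal_leI) simp
        qed
      qed
      then show "\<forall>\<^sub>F k in sequentially. (\<integral>\<^sup>+x. norm (f x m n - s k x m n) \<partial>M)
          \<le> (\<integral>\<^sup>+x. ennreal (nrm (l1_lr r) (f x - s k x)) \<partial>M)" by simp
    qed simp
    have "simple_integral_on (l1_lr r) M (s k) \<in> carr (l1_lr r)" for k
    proof -
      have m: "module (scl (l1_lr r))"
        using vector_space_l1_lr by (simp add: module_iff_vector_space)
      show ?thesis unfolding simple_integral_on_def
        by (intro module.subspace_sum[OF m subspace_carr[OF r]] module.subspace_scale[OF m subspace_carr[OF r]])
          (auto simp: sc)
    qed
    then have "\<forall>\<^sub>F k in sequentially. simple_integral_on (l1_lr r) M (s k) - y \<in> carr (l1_lr r)"
      using l1_lr_diff[OF r _ y] by simp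
    from l1_lr_nrm_tendsto_coord[OF r0 this lim, of m n]
    have "(\<lambda>k. simple_integral_on (l1_lr r) M (s k) m n - y m n) \<longlonglongrightarrow> 0" by simp
    then show "(\<lambda>k. Bochner_Integration.simple_bochner_integral M (\<lambda>x. s k x m n)) \<longlonglongrightarrow> y m n"
      unfolding simple_integral_on_coord(2)[OF s] by (simp add: LIM_zero_iff)
  qed
qed

definition block :: "nat \<Rightarrow> nat \<Rightarrow> (nat \<Rightarrow> nat \<Rightarrow> complex) \<Rightarrow> nat \<Rightarrow> nat \<Rightarrow> complex" where
  "block M N x = (\<lambda>m n. if m < M \<and> n < N then x m n else 0)"

lemma block_norm_le:
  assumes r: "1 \<le> r"
  shows "block M N x \<in> carr (l1_lr r)" "nrm (l1_lr r) (block M N x) \<le> (\<Sum>m<M. \<Sum>n<N. cmod (x m n))"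
proof -
  have r0: "0 < r" using r by simp
  have "partial_norm r (block M N x) M' N' \<le> (\<Sum>m<M. \<Sum>n<N. cmod (x m n))" for M' N'
  proof -
    have "(\<Sum>n<N'. cmod (block M N x m n) powr r) powr (1 / r) \<le> (\<Sum>n<N'. cmod (block M N x m n))" for m
      using root_of_sum_le[OF r, of "{..<N'}" "\<lambda>n. cmod (block M N x m n) powr r"] r by (simp add: powr_powr)
    also have "(\<Sum>n<N'. cmod (block M N x m n)) \<le> (if m < M then (\<Sum>n<N. cmod (x m n)) else 0)" for m
    proof -
      have "(\<Sum>n<N'. cmod (block M N x m n)) = (\<Sum>n\<in>{..<N'} \<inter> {..<N}. cmod (block M N x m n))"
        by (rule sum.mono_neutral_right) (auto simp: block_def)
      also have "\<dots> \<le> (\<Sum>n<N. cmod (block M N x m n))" by (rule sum_mono2) auto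
      also have "\<dots> = (if m < M then (\<Sum>n<N. cmod (x m n)) else 0)" by (simp add: block_def)
      finally show ?thesis .
    qed
    finally have "partial_norm r (block M N x) M' N' \<le> (\<Sum>m<M'. if m < M then (\<Sum>n<N. cmod (x m n)) else 0)"
      unfolding partial_norm_def by (intro sum_mono)
    also have "\<dots> = (\<Sum>m\<in>{..<M'} \<inter> {..<M}. (\<Sum>n<N. cmod (x m n)))"
      by (intro sum.mono_neutral_cong_right) auto
    also have "\<dots> \<le> (\<Sum>m<M. \<Sum>n<N. cmod (x m n))" by (rule sum_mono2) (auto intro: sum_nonneg)
    finally show ?thesis .
  qed
  from l1_lrI[OF r0 this]
  show "block M N x \<in> carr (l1_lr r)" "nrm (l1_lr r) (block M N x) \<le> (\<Sum>m<M. \<Sum>n<N. cmod (x m n))" by auto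
qed

lemma block_diff: "block M N x - block M N y = block M N (x - y)"
  by (simp add: block_def fun_eq_iff)

lemma block_tendsto_zero:
  assumes r: "1 \<le> r" and lim: "\<And>m n. ((\<lambda>w. x w m n) \<longlongrightarrow> 0) F"
  shows "((\<lambda>w. nrm (l1_lr r) (block M N (x w))) \<longlongrightarrow> 0) F"
proof (rule tendsto_sandwich[OF _ _ tendsto_const])
  have "((\<lambda>w. (\<Sum>m<M. \<Sum>n<N. cmod (x w m n))) \<longlongrightarrow> (\<Sum>m<M. \<Sum>n<N. 0)) F"
    by (intro tendsto_sum tendsto_norm_zero lim)
  then show "((\<lambda>w. (\<Sum>m<M. \<Sum>n<N. cmod (x w m n))) \<longlongrightarrow> 0) F" by simp
qed (use r in \<open>auto simp: block_norm_le nrm_nonneg\<close>)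

text \<open>A block of simple scalar functions factors through the tuple of its finitely many
  entries, which is simple by induction on the index set.\<close>

lemma simple_function_block:
  assumes "\<And>m n. simple_function M (\<lambda>x. s x m n)"
  shows "simple_function M (\<lambda>x. block A B (s x))"
proof -
  define P where "P = {..<A} \<times> {..<B}"
  define G where "G = (\<lambda>x. restrict (\<lambda>(m, n). s x m n) P)"
  have "finite P" by (simp add: P_def)
  have G: "simple_function M (\<lambda>x. \<lambda>p\<in>Q. s x (fst p) (snd p))" if "finite Q" for Q
    using that
  proof (induction rule: finite_induct)
    case empty
    then show ?case by simp
  next
    case (insert q Q)
    have "simple_function M (\<lambda>x. (\<lambda>(a, b). \<lambda>p\<in>insert q Q. if p = q then b else a p)
        ((\<lambda>p\<in>Q. s x (fst p) (snd p)), s x (fst q) (snd q)))"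
      by (intro simple_function_compose1[OF simple_function_Pair] insert.IH assms)
    also have "(\<lambda>x. (\<lambda>(a, b). \<lambda>p\<in>insert q Q. if p = q then b else a p)
        ((\<lambda>p\<in>Q. s x (fst p) (snd p)), s x (fst q) (snd q))) = (\<lambda>x. \<lambda>p\<in>insert q Q. s x (fst p) (snd p))"
      using insert.hyps by (auto simp: fun_eq_iff restrict_def)
    finally show ?case .
  qed
  have "simple_function M (\<lambda>x. block A B ((\<lambda>g m n. g (m, n)) (\<lambda>p\<in>P. s x (fst p) (snd p))))"
    by (rule simple_function_compose1[OF G[OF \<open>finite P\<close>]])
  also have "(\<lambda>x. block A B ((\<lambda>g m n. g (m, n)) (\<lambda>p\<in>P. s x (fst p) (snd p)))) = (\<lambda>x. block A B (s x))"
    by (auto simp: fun_eq_iff block_def P_def)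
  finally show ?thesis .
qed

text \<open>On a block the norm is at most the sum of the moduli of finitely many
  coordinates, so approximations of the coordinates assemble into an approximation of the
  vector-valued function.\<close>

lemma has_bochner_integral_on_block:
  assumes r: "1 \<le> r" and fin: "finite_measure M"
    and int: "\<And>m n. has_bochner_integral M (\<lambda>x. g x m n) (y m n)"
  shows "has_bochner_integral_on (l1_lr r) M (\<lambda>x. block A B (g x)) (block A B y)"
proof -
  \<comment> \<open>Naming the property lets one choose an approximating sequence for every coordinate at once.\<close>
  define Q where "Q = (\<lambda>m n (s :: nat \<Rightarrow> 'a \<Rightarrow> complex).
      (\<forall>k. Bochner_Integration.simple_bochner_integrable M (s k)) \<and>
      (\<lambda>k. \<integral>\<^sup>+x. norm (g x m n - s k x) \<partial>M) \<longlonglongrightarrow> 0 \<and>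
      (\<lambda>k. Bochner_Integration.simple_bochner_integral M (s k)) \<longlonglongrightarrow> y m n)"
  have "\<exists>s. Q m n s" for m n
    using int[of m n] by (auto simp: Q_def elim!: has_bochner_integral.cases)
  then obtain s where "\<And>m n. Q m n (s m n)" by metis
  then have s: "\<And>m n k. Bochner_Integration.simple_bochner_integrable M (s m n k)"
    and l1: "\<And>m n. (\<lambda>k. \<integral>\<^sup>+x. norm (g x m n - s m n k x) \<partial>M) \<longlonglongrightarrow> 0"
    and lim: "\<And>m n. (\<lambda>k. Bochner_Integration.simple_bochner_integral M (s m n k)) \<longlonglongrightarrow> y m n"
    by (auto simp: Q_def)
  have meas: "(\<lambda>x. g x m n) \<in> borel_measurable M" for m n
    using int by (rule borel_measurable_has_bochner_integral)
  have "\<exists>u. \<forall>k::nat. simple_function M (u k) \<and> (\<forall>x\<in>space M. (\<lambda>k. u k x) \<longlonglongrightarrow> g x m n)" for m n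
    using borel_measurable_implies_sequence_metric[OF meas[of m n], of 0] by metis
  then obtain u where u: "\<And>m n (k::nat). simple_function M (u m n k)"
    and u_lim: "\<And>m n x. x \<in> space M \<Longrightarrow> (\<lambda>k. u m n k x) \<longlonglongrightarrow> g x m n" by metis
  show ?thesis unfolding has_bochner_integral_on_def
  proof (intro conjI)
    show "strongly_measurable (l1_lr r) M (\<lambda>x. block A B (g x))"
      unfolding strongly_measurable_def
    proof (intro conjI exI[of _ "\<lambda>k x. block A B (\<lambda>m n. u m n k x)"] allI AE_I2)
      fix x assume x: "x \<in> space M"
      have "(\<lambda>k. (g x - (\<lambda>m n. u m n k x)) m n) \<longlonglongrightarrow> 0" for m n
        using tendsto_diff[OF tendsto_const u_lim[OF x, of m n], of "g x m n"] by simp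
      then show "(\<lambda>k. nrm (l1_lr r) (block A B (g x) - block A B (\<lambda>m n. u m n k x))) \<longlonglongrightarrow> 0"
        unfolding block_diff by (rule block_tendsto_zero[OF r])
    qed (use block_norm_le(1)[OF r] in \<open>auto intro: simple_function_block u\<close>)
    show "\<exists>t. (\<forall>k::nat. simple_integrable_on (l1_lr r) M (t k)) \<and>
          (\<lambda>k. \<integral>\<^sup>+x. ennreal (nrm (l1_lr r) (block A B (g x) - t k x)) \<partial>M) \<longlonglongrightarrow> 0 \<and>
          (\<lambda>k. nrm (l1_lr r) (simple_integral_on (l1_lr r) M (t k) - block A B y)) \<longlonglongrightarrow> 0"
    proof (intro exI conjI allI)
      have sf: "simple_function M (s m n k)" for m n k
        using s by (auto elim: simple_bochner_integrable.cases)
      show si: "simple_integrable_on (l1_lr r) M (\<lambda>x. block A B (\<lambda>m n. s m n k x))" for k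
        unfolding simple_integrable_on_def
        using block_norm_le(1)[OF r] finite_measure.emeasure_finite[OF fin]
        by (auto intro: simple_function_block sf)
      show "(\<lambda>k. \<integral>\<^sup>+x. ennreal (nrm (l1_lr r) (block A B (g x) - block A B (\<lambda>m n. s m n k x))) \<partial>M) \<longlonglongrightarrow> 0"
      proof (rule tendsto_sandwich[OF _ _ tendsto_const])
        have sm: "(\<lambda>x. ennreal (norm (g x m n - s m n k x))) \<in> borel_measurable M" for m n k
        proof -
          have [measurable]: "s m n k \<in> borel_measurable M" "(\<lambda>x. g x m n) \<in> borel_measurable M"
            by (rule borel_measurable_simple_function[OF sf]) (rule meas)
          show ?thesis by measurable
        qed
        have "(\<integral>\<^sup>+x. ennreal (nrm (l1_lr r) (block A B (g x) - block A B (\<lambda>m n. s m n k x))) \<partial>M)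
          \<le> (\<Sum>m<A. \<Sum>n<B. (\<integral>\<^sup>+x. norm (g x m n - s m n k x) \<partial>M))" for k
        proof -
          have "nrm (l1_lr r) (block A B (g x) - block A B (\<lambda>m n. s m n k x))
            \<le> (\<Sum>m<A. \<Sum>n<B. norm (g x m n - s m n k x))" for x
            unfolding block_diff using block_norm_le(2)[OF r, of A B "g x - (\<lambda>m n. s m n k x)"] by simp
          then have "(\<integral>\<^sup>+x. ennreal (nrm (l1_lr r) (block A B (g x) - block A B (\<lambda>m n. s m n k x))) \<partial>M)
            \<le> (\<integral>\<^sup>+x. ennreal (\<Sum>m<A. \<Sum>n<B. norm (g x m n - s m n k x)) \<partial>M)"
            by (intro nn_integral_mono ennreal_leI)
          also have "\<dots> = (\<integral>\<^sup>+x. (\<Sum>m<A. \<Sum>n<B. ennreal (norm (g x m n - s m n k x))) \<partial>M)"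
            by (intro nn_integral_cong) (simp add: sum_ennreal sum_nonneg)
          also have "\<dots> = (\<Sum>m<A. (\<integral>\<^sup>+x. (\<Sum>n<B. ennreal (norm (g x m n - s m n k x))) \<partial>M))"
            by (intro nn_integral_sum borel_measurable_sum sm)
          also have "\<dots> = (\<Sum>m<A. \<Sum>n<B. (\<integral>\<^sup>+x. norm (g x m n - s m n k x) \<partial>M))"
            by (intro sum.cong refl nn_integral_sum sm)
          finally show ?thesis .
        qed
        then show "\<forall>\<^sub>F k in sequentially. (\<integral>\<^sup>+x. ennreal (nrm (l1_lr r) (block A B (g x) - block A B (\<lambda>m n. s m n k x))) \<partial>M)
          \<le> (\<Sum>m<A. \<Sum>n<B. (\<integral>\<^sup>+x. norm (g x m n - s m n k x) \<partial>M))" by simp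
        have "(\<lambda>k. \<Sum>m<A. \<Sum>n<B. (\<integral>\<^sup>+x. norm (g x m n - s m n k x) \<partial>M)) \<longlonglongrightarrow> (\<Sum>m<A. \<Sum>n<B. 0)"
          by (intro tendsto_sum l1)
        then show "(\<lambda>k. \<Sum>m<A. \<Sum>n<B. (\<integral>\<^sup>+x. norm (g x m n - s m n k x) \<partial>M)) \<longlonglongrightarrow> 0" by simp
      qed simp
      have eq: "simple_integral_on (l1_lr r) M (\<lambda>x. block A B (\<lambda>m n. s m n k x))
          = block A B (\<lambda>m n. Bochner_Integration.simple_bochner_integral M (s m n k))" for k
      proof (intro ext)
        fix m n
        show "simple_integral_on (l1_lr r) M (\<lambda>x. block A B (\<lambda>m n. s m n k x)) m n
          = block A B (\<lambda>m n. Bochner_Integration.simple_bochner_integral M (s m n k)) m n"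
          unfolding simple_integral_on_coord(2)[OF si]
          by (auto simp: block_def simple_bochner_integral_def intro!: sum.neutral)
      qed
      have "(\<lambda>k. ((\<lambda>m n. Bochner_Integration.simple_bochner_integral M (s m n k)) - y) m n) \<longlonglongrightarrow> 0" for m n
        using LIM_zero[OF lim[of m n]] by (simp only: minus_apply)
      then show "(\<lambda>k. nrm (l1_lr r) (simple_integral_on (l1_lr r) M (\<lambda>x. block A B (\<lambda>m n. s m n k x)) - block A B y)) \<longlonglongrightarrow> 0"
        unfolding eq block_diff by (rule block_tendsto_zero[OF r])
    qed
  qed (rule block_norm_le(1)[OF r])
qed

lemma bochner_integral_on_block:
  assumes r: "1 \<le> r" and fin: "finite_measure M"
    and int: "\<And>m n. has_bochner_integral M (\<lambda>x. g x m n) (y m n)"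
  shows "bochner_integral_on (l1_lr r) M (\<lambda>x. block A B (g x)) = block A B y"
proof -
  have h: "has_bochner_integral_on (l1_lr r) M (\<lambda>x. block A B (g x)) (block A B y)"
    by (rule has_bochner_integral_on_block[OF assms])
  have *: "(\<lambda>x. block A B (g x) m n) \<in> borel_measurable M" for m n
    using borel_measurable_has_bochner_integral[OF int] by (cases "m < A \<and> n < B") (auto simp: block_def)
  have "z = block A B y" if "has_bochner_integral_on (l1_lr r) M (\<lambda>x. block A B (g x)) z" for z
    using has_bochner_integral_eq[OF has_bochner_integral_on_coord[OF r that *] has_bochner_integral_on_coord[OF r h *]]
    by (simp add: fun_eq_iff)
  then have "(THE z. has_bochner_integral_on (l1_lr r) M (\<lambda>x. block A B (g x)) z) = block A B y"
    using h by (intro the_equality)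
  then show ?thesis unfolding bochner_integral_on_def using h by (subst if_P) blast+
qed

section \<open>Step data and their mild solutions\<close>

definition slot :: "real \<Rightarrow> nat \<Rightarrow> real set" where
  "slot \<delta> m = {real m * \<delta>..<real (Suc m) * \<delta>}"

text \<open>The datum of the counterexample. The slots of the \<open>2\<^sup>N\<^sup>+\<^sup>1\<close> rows have length \<open>\<tau> / 2\<^sup>N\<close>, so they tile
  \<open>[0, 2\<tau>)\<close>.\<close>

definition step_data :: "real \<Rightarrow> nat \<Rightarrow> real \<Rightarrow> nat \<Rightarrow> nat \<Rightarrow> complex" where
  "step_data \<tau> N s = block (2 ^ Suc N) N (\<lambda>m n. complex_of_real (indicator (slot (\<tau> / 2 ^ N) m) s))"

lemma slot_index:
  assumes "0 < \<delta>" "0 \<le> s"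
  shows "s \<in> slot \<delta> m \<longleftrightarrow> m = nat \<lfloor>s / \<delta>\<rfloor>"
proof -
  have "s \<in> slot \<delta> m \<longleftrightarrow> real m \<le> s / \<delta> \<and> s / \<delta> < real m + 1"
    using assms(1) by (simp add: slot_def pos_le_divide_eq pos_divide_less_eq algebra_simps)
  also have "\<dots> \<longleftrightarrow> \<lfloor>s / \<delta>\<rfloor> = int m" by (simp add: floor_eq_iff)
  also have "\<dots> \<longleftrightarrow> m = nat \<lfloor>s / \<delta>\<rfloor>" using assms by auto
  finally show ?thesis .
qed

lemma nrm_block_row:
  assumes r: "0 < r" and k: "k < M"
  shows "nrm (l1_lr r) (block M N (\<lambda>m n. of_bool (m = k))) = real N powr (1 / r)"
proof -
  have "(\<Sum>n. cmod (block M N (\<lambda>m n. of_bool (m = k)) m n) powr r) = of_bool (m = k) * real N" for m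
    using r k by (subst suminf_finite[of "{..<N}"]) (auto simp: block_def)
  then show ?thesis
    by (simp add: l1_lr_def) (subst suminf_finite[of "{k}"], auto)
qed

text \<open>The slots are disjoint, so exactly one row is active at each time in \<open>[0, 2\<tau>)\<close>.\<close>

lemma nrm_step_data:
  assumes r: "0 < r" and \<tau>: "0 < \<tau>"
  shows "nrm (l1_lr r) (step_data \<tau> N s) = (if s \<in> {0..<2 * \<tau>} then real N powr (1 / r) else 0)"
proof -
  define \<delta> where "\<delta> = \<tau> / 2 ^ N"
  have \<delta>: "0 < \<delta>" using \<tau> by (simp add: \<delta>_def)
  have M: "real (2 ^ Suc N) * \<delta> = 2 * \<tau>" by (simp add: \<delta>_def)
  show ?thesis
  proof (cases "s \<in> {0..<2 * \<tau>}")
    case True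
    define k where "k = nat \<lfloor>s / \<delta>\<rfloor>"
    have "s / \<delta> < real (2 ^ Suc N)" using True \<delta> M by (simp only: pos_divide_less_eq atLeastLessThan_iff)
    then have "k < 2 ^ Suc N" using True \<delta> unfolding k_def by (subst nat_less_iff) (auto simp: floor_less_iff)
    moreover have "step_data \<tau> N s = block (2 ^ Suc N) N (\<lambda>m n. of_bool (m = k))"
      using slot_index[OF \<delta>, of s] True by (auto simp: step_data_def k_def \<delta>_def indicator_def intro!: arg_cong[of _ _ "block _ _"])
    ultimately show ?thesis using True nrm_block_row[OF r] by simp
  next
    case False
    have "s \<notin> slot \<delta> m" if "m < 2 ^ Suc N" for m
    proof
      assume s: "s \<in> slot \<delta> m"
      have "real (Suc m) * \<delta> \<le> real (2 ^ Suc N) * \<delta>"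
        using that \<delta> by (intro mult_right_mono) (simp_all only: of_nat_le_iff Suc_le_eq less_imp_le)
      then have "s < 2 * \<tau>" using s unfolding M slot_def by simp
      moreover have "0 \<le> real m * \<delta>" using \<delta> by simp
      ultimately show False using s False by (simp add: slot_def)
    qed
    then have "step_data \<tau> N s = 0" by (auto simp: step_data_def block_def fun_eq_iff \<delta>_def)
    then show ?thesis using l1_lr_zero[OF r] by (simp only: if_not_P[OF False])
  qed
qed

lemma slot_sets: "slot \<delta> m \<in> sets lebesgue" by (simp add: slot_def)

lemma strongly_measurable_step_data:
  assumes r: "1 \<le> r" and I: "I \<in> sets lebesgue"
  shows "strongly_measurable (l1_lr r) (lebesgue_on I) (step_data \<tau> N)"
proof -
  have "simple_function (lebesgue_on I) (\<lambda>s. complex_of_real (indicator (slot \<delta> m) s))" for \<delta> m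
  proof (rule simple_function_compose1[where f = "indicator (slot \<delta> m)"])
    have "indicator (slot \<delta> m) \<in> borel_measurable (lebesgue_on I)"
      using slot_sets by (intro measurable_restrict_space1 borel_measurable_indicator)
    moreover have "finite ((indicator (slot \<delta> m) :: real \<Rightarrow> real) ` space (lebesgue_on I))"
      by (rule finite_subset[of _ "{0, 1}"]) (auto simp: indicator_def)
    ultimately show "simple_function (lebesgue_on I) (indicator (slot \<delta> m) :: real \<Rightarrow> real)"
      by (rule simple_function_borel_measurable)
  qed
  then have "simple_function (lebesgue_on I) (step_data \<tau> N)"
    unfolding step_data_def by (intro simple_function_block)
  moreover have "step_data \<tau> N s \<in> carr (l1_lr r)" for s
    unfolding step_data_def by (rule block_norm_le(1)[OF r])
  ultimately show ?thesis unfolding strongly_measurable_def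
    using l1_lr_zero[of r] r by (intro conjI exI[of _ "\<lambda>_. step_data \<tau> N"]) auto
qed

text \<open>The scalar mild solution in coordinate \<open>(m, n)\<close>, without the factor \<open>a\<^sub>n\<close> that \<open>A\<close> contributes.\<close>

definition response :: "real \<Rightarrow> real \<Rightarrow> nat \<Rightarrow> nat \<Rightarrow> real" where
  "response \<delta> t m n = (\<integral>s. exp (- entry n * (t - s)) * indicator (slot \<delta> m) s \<partial>lebesgue_on {0<..<t})"

lemma finite_measure_lebesgue_on_interval: "finite_measure (lebesgue_on {0<..<t::real})"
  by (rule finite_measureI, cases "0 \<le> t") (simp_all add: emeasure_restrict_space space_restrict_space)

lemma response_integrable:
  "integrable (lebesgue_on {0<..<t}) (\<lambda>s. exp (- entry n * (t - s)) * indicator (slot \<delta> m) s)"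
proof (rule finite_measure.integrable_const_bound[OF finite_measure_lebesgue_on_interval, of _ 1])
  have "(\<lambda>s. exp (- entry n * (t - s)) * indicator (slot \<delta> m) s) \<in> borel_measurable lborel"
    unfolding slot_def by measurable
  then show "(\<lambda>s. exp (- entry n * (t - s)) * indicator (slot \<delta> m) s) \<in> borel_measurable (lebesgue_on {0<..<t})"
    by (intro measurable_restrict_space1 measurable_completion)
qed (auto simp: indicator_def)

lemma mild_solution_step_data:
  assumes r: "1 \<le> r"
  shows "mild_solution (l1_lr r) (\<lambda>t. diag_exp (complex_of_real t)) (step_data \<tau> N) t
    = block (2 ^ Suc N) N (\<lambda>m n. complex_of_real (response (\<tau> / 2 ^ N) t m n))"
proof -
  have "diag_exp (complex_of_real (t - s)) (step_data \<tau> N s) = block (2 ^ Suc N) N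
      (\<lambda>m n. complex_of_real (exp (- entry n * (t - s)) * indicator (slot (\<tau> / 2 ^ N) m) s))" for s
    by (simp add: step_data_def diag_exp_def diag_mult_def block_def fun_eq_iff exp_of_real[symmetric])
  moreover have "bochner_integral_on (l1_lr r) (lebesgue_on {0<..<t}) (\<lambda>s. block (2 ^ Suc N) N
      (\<lambda>m n. complex_of_real (exp (- entry n * (t - s)) * indicator (slot (\<tau> / 2 ^ N) m) s)))
    = block (2 ^ Suc N) N (\<lambda>m n. complex_of_real (response (\<tau> / 2 ^ N) t m n))"
    unfolding response_def
    by (intro bochner_integral_on_block r finite_measure_lebesgue_on_interval has_bochner_integral_of_real
        has_bochner_integral_integrable response_integrable)
  ultimately show ?thesis by (simp add: mild_solution_def)
qed

text \<open>The kernel is increasing in \<open>s\<close>, so on the slot it is at least its value at the left end point. The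
  condition \<open>0 < m\<close> keeps the slot inside the open interval of integration.\<close>

lemma response_lower_bound:
  assumes \<delta>: "0 < \<delta>" and m: "0 < m" "real (Suc m) * \<delta> \<le> t"
  shows "\<delta> * exp (- entry n * (t - real m * \<delta>)) \<le> response \<delta> t m n"
proof -
  have sub: "slot \<delta> m \<subseteq> {0<..<t}"
  proof -
    have "0 < real m * \<delta>" using m(1) \<delta> by simp
    then show ?thesis using m(2) unfolding slot_def by auto
  qed
  have "measure (lebesgue_on {0<..<t}) (slot \<delta> m) = measure lebesgue (slot \<delta> m)"
    using sub by (intro measure_restrict_space) auto
  also have "\<dots> = \<delta>" using \<delta> by (simp add: slot_def algebra_simps)
  finally have "\<delta> * exp (- entry n * (t - real m * \<delta>)) =
      (\<integral>s. exp (- entry n * (t - real m * \<delta>)) * indicator (slot \<delta> m) s \<partial>lebesgue_on {0<..<t})"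
    using sub by (simp add: Int_absorb2 space_restrict_space)
  also have "\<dots> \<le> response \<delta> t m n" unfolding response_def
  proof (rule integral_mono[OF _ response_integrable])
    show "integrable (lebesgue_on {0<..<t}) (\<lambda>s. exp (- entry n * (t - real m * \<delta>)) * indicator (slot \<delta> m) s)"
      using sub by (intro integrable_mult_right finite_measure.integrable_const_bound[OF finite_measure_lebesgue_on_interval, of _ 1]
        measurable_restrict_space1 borel_measurable_indicator slot_sets) (auto simp: indicator_def)
    show "exp (- entry n * (t - real m * \<delta>)) * indicator (slot \<delta> m) s \<le> exp (- entry n * (t - s)) * indicator (slot \<delta> m) s" for s
      by (auto simp: indicator_def slot_def)
  qed
  finally show ?thesis .
qed

text \<open>A lower bound of harmonic type: each of the \<open>N\<close> dyadic blocks contributes \<open>c\<close>.\<close>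

lemma dyadic_sum_lower_bound:
  fixes b :: "nat \<Rightarrow> real"
  assumes "\<And>i j. i < N \<Longrightarrow> 2 ^ i \<le> j \<Longrightarrow> j < 2 ^ Suc i \<Longrightarrow> c / 2 ^ i \<le> b j"
  shows "real N * c \<le> (\<Sum>j = 1..<2 ^ N. b j)"
  using assms
proof (induction N)
  case (Suc N)
  have "c = (\<Sum>j\<in>{2 ^ N..<2 ^ Suc N::nat}. c / 2 ^ N)" by simp
  also have "\<dots> \<le> (\<Sum>j\<in>{2 ^ N..<2 ^ Suc N}. b j)" using Suc.prems[of N] by (intro sum_mono) auto
  finally have "real (Suc N) * c \<le> (\<Sum>j = 1..<2 ^ N. b j) + (\<Sum>j\<in>{2 ^ N..<2 ^ Suc N}. b j)"
    using Suc by (simp add: algebra_simps)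
  also have "\<dots> = (\<Sum>j = 1..<2 ^ Suc N. b j)"
    by (rule sum.atLeastLessThan_concat) auto
  finally show ?case .
qed simp

text \<open>The active slot at time \<open>t\<close> has index \<open>k\<close> between \<open>2\<^sup>N\<close> and \<open>2\<^sup>N\<^sup>+\<^sup>1\<close>. In the row \<open>j\<close> steps back only one
  coordinate is used, the one whose time scale \<open>1 / a\<^sub>n\<close> matches the elapsed time \<open>j\<delta>\<close> up to a
  bounded factor.\<close>

lemma nrm_regular_solution_ge:
  assumes r: "1 \<le> r" and \<tau>: "0 < \<tau>" and t: "t \<in> {\<tau>..<2 * \<tau>}"
  shows "real N * (\<tau> * exp (- 2 * \<tau>)) \<le> nrm (l1_lr r) (diag_op
    (mild_solution (l1_lr r) (\<lambda>t. diag_exp (complex_of_real t)) (step_data \<tau> N) t))"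
proof -
  define \<delta> where "\<delta> = \<tau> / 2 ^ N"
  define u where "u = diag_op (mild_solution (l1_lr r) (\<lambda>t. diag_exp (complex_of_real t)) (step_data \<tau> N) t)"
  define k where "k = nat \<lfloor>t / \<delta>\<rfloor>"
  define row where "row = (\<lambda>m. (\<Sum>n<N. cmod (u m n) powr r) powr (1 / r))"
  have r0: "0 < r" using r by simp
  have \<delta>: "0 < \<delta>" using \<tau> by (simp add: \<delta>_def)
  have u: "u = block (2 ^ Suc N) N (\<lambda>m n. complex_of_real (entry n * response \<delta> t m n))"
    unfolding u_def mild_solution_step_data[OF r]
    by (simp add: diag_op_eq_diag_mult diag_mult_def block_def fun_eq_iff \<delta>_def)
  have kt: "t \<in> slot \<delta> k" using slot_index[OF \<delta>, of t] t \<tau> by (simp add: k_def)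
  have "t / \<delta> = t / \<tau> * 2 ^ N" by (simp add: \<delta>_def)
  moreover have "1 \<le> t / \<tau>" "t / \<tau> < 2" using t \<tau> by (auto simp: field_simps)
  ultimately have "2 ^ N \<le> t / \<delta>" "t / \<delta> < 2 ^ Suc N"
    using mult_right_mono[of 1 "t / \<tau>" "2 ^ N"] mult_strict_right_mono[of "t / \<tau>" 2 "2 ^ N"] by simp_all
  then have "int (2 ^ N) \<le> \<lfloor>t / \<delta>\<rfloor>" "\<lfloor>t / \<delta>\<rfloor> < int (2 ^ Suc N)"
    by (simp_all add: le_floor_iff floor_less_iff)
  then have k: "2 ^ N \<le> k" "k < 2 ^ Suc N" unfolding k_def by linarith+
  have "\<tau> * exp (- 2 * \<tau>) / 2 ^ i \<le> row (k - j)"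
    if i: "i < N" and j: "2 ^ i \<le> j" "j < 2 ^ Suc i" for i j
  proof -
    define m where "m = k - j"
    \<comment> \<open>This makes \<open>a\<^sub>n = 2\<^sup>N\<^sup>-\<^sup>i\<close>, the entry with \<open>a\<^sub>n \<delta> = \<tau> / 2\<^sup>i\<close>.\<close>
    define n where "n = N - Suc i"
    have "j < (2::nat) ^ N" using j(2) power_increasing[of "Suc i" N "2::nat"] i by linarith
    then have m: "0 < m" "Suc m \<le> k" "k = m + j" using k j one_le_power[of "2::nat" i] unfolding m_def by linarith+
    have n: "n < N" "Suc n + i = N" using i by (simp_all add: n_def)
    have entry\<delta>: "entry n * \<delta> = \<tau> / 2 ^ i"
      unfolding entry_def \<delta>_def n(2)[symmetric] by (simp add: power_add)
    have "real (Suc m) * \<delta> \<le> real k * \<delta>" using m \<delta> by (intro mult_right_mono) simp_all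
    then have tm: "real (Suc m) * \<delta> \<le> t" using kt by (simp add: slot_def)
    have "t - real m * \<delta> \<le> real (Suc j) * \<delta>"
      using kt m(3) by (simp add: slot_def algebra_simps)
    also have "\<dots> \<le> real (2 ^ Suc i) * \<delta>"
      using j \<delta> by (intro mult_right_mono) (simp_all only: of_nat_le_iff Suc_le_eq less_imp_le)
    finally have "entry n * (t - real m * \<delta>) \<le> entry n * (real (2 ^ Suc i) * \<delta>)"
      by (intro mult_left_mono) auto
    also have "\<dots> = real (2 ^ Suc i) * (entry n * \<delta>)" by simp
    also have "\<dots> = 2 * \<tau>" unfolding entry\<delta> by simp
    finally have "exp (- 2 * \<tau>) \<le> exp (- entry n * (t - real m * \<delta>))" by simp
    then have "entry n * \<delta> * exp (- 2 * \<tau>) \<le> entry n * \<delta> * exp (- entry n * (t - real m * \<delta>))"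
      using \<delta> by (intro mult_left_mono) auto
    also have "\<dots> \<le> entry n * response \<delta> t m n"
      using response_lower_bound[OF \<delta> m(1) tm, of n] by (simp add: mult.assoc)
    also have "\<dots> \<le> cmod (u m n)"
      using n(1) m(2) k(2) by (simp add: u block_def norm_mult mult_left_mono)
    also have "\<dots> \<le> row m" unfolding row_def by (rule coord_le_row[OF r0 n(1)])
    finally show ?thesis unfolding entry\<delta> m_def by simp
  qed
  then have "real N * (\<tau> * exp (- 2 * \<tau>)) \<le> (\<Sum>j = 1..<2 ^ N. row (k - j))"
    by (rule dyadic_sum_lower_bound)
  also have "\<dots> = (\<Sum>m\<in>(\<lambda>j. k - j) ` {1..<2 ^ N}. row m)"
    using k by (subst sum.reindex) (auto simp: inj_on_def)
  also have "\<dots> \<le> (\<Sum>m<2 ^ Suc N. row m)"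
    using k by (intro sum_mono2) (auto simp: row_def)
  also have "\<dots> = partial_norm r u (2 ^ Suc N) N" by (simp add: partial_norm_def row_def)
  also have "\<dots> \<le> nrm (l1_lr r) u"
    unfolding u by (intro partial_norm_le_nrm r0 block_norm_le(1)[OF r])
  finally show ?thesis unfolding u_def .
qed

section \<open>Comparison of \<open>L\<^sup>p\<close> norms\<close>

text \<open>The \<open>L\<^sup>p\<close> norm of the indicator function of a set of measure \<open>\<sigma> > 0\<close>.\<close>

definition Lp_weight :: "ennreal \<Rightarrow> real \<Rightarrow> real" where
  "Lp_weight p \<sigma> = (if p = \<infinity> then 1 else \<sigma> powr (1 / enn2real p))"

lemma Lp_norm_le_indicator:
  assumes p: "1 \<le> p" and A: "A \<in> sets M" "emeasure M A \<le> ennreal \<sigma>" and \<alpha>: "0 \<le> \<alpha>" "0 \<le> \<sigma>"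
    and f: "\<And>s. s \<in> space M \<Longrightarrow> nrm V (f s) = (if s \<in> A then \<alpha> else 0)"
  shows "Lp_norm V M p f \<le> ennreal (\<alpha> * Lp_weight p \<sigma>)"
proof (cases "p = \<infinity>")
  case True
  have "(\<lambda>s. ennreal (nrm V (f s))) \<in> borel_measurable M"
    using A(1) by (subst measurable_cong[of _ _ "\<lambda>s. if s \<in> A then ennreal \<alpha> else 0"]) (auto simp: f)
  then have "esssup M (\<lambda>s. ennreal (nrm V (f s))) \<le> ennreal \<alpha>"
    using \<alpha> by (intro esssup_I AE_I2) (auto simp: f)
  then show ?thesis using True by (simp add: Lp_norm_def Lp_weight_def)
next
  case False
  define q where "q = enn2real p"
  have q: "0 < q" using p False unfolding q_def by (subst enn2real_positive_iff) (auto simp: top.not_eq_extremum less_le_trans[OF zero_less_one])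
  define J where "J = (\<integral>\<^sup>+s. ennreal (nrm V (f s) powr q) \<partial>M)"
  have "J = (\<integral>\<^sup>+s. ennreal (\<alpha> powr q) * indicator A s \<partial>M)"
    unfolding J_def by (intro nn_integral_cong) (simp add: f indicator_def)
  also have "\<dots> = ennreal (\<alpha> powr q) * emeasure M A" using A(1) by (rule nn_integral_cmult_indicator)
  also have "\<dots> \<le> ennreal (\<alpha> powr q) * ennreal \<sigma>" using A(2) by (rule mult_left_mono) simp
  finally have J: "J \<le> ennreal (\<alpha> powr q * \<sigma>)" by (simp add: ennreal_mult')
  then have "J \<noteq> \<infinity>" by (auto simp: top_unique)
  have "enn2real J \<le> \<alpha> powr q * \<sigma>" using J \<alpha> by (intro enn2real_leI) auto
  then have "enn2real J powr (1 / q) \<le> (\<alpha> powr q * \<sigma>) powr (1 / q)" using q by (intro powr_mono2) auto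
  also have "\<dots> = \<alpha> * \<sigma> powr (1 / q)" using q \<alpha> by (simp add: powr_mult powr_powr)
  finally show ?thesis using False \<open>J \<noteq> \<infinity>\<close>
    unfolding Lp_norm_def Lp_weight_def Let_def J_def q_def by (simp add: ennreal_leI)
qed

text \<open>Monotonicity of the nonnegative integral, and the fact that the essential supremum is an almost
  everywhere upper bound, hold for arbitrary functions; hence \<open>g\<close> may be any function.\<close>

lemma Lp_norm_ge_indicator:
  assumes p: "1 \<le> p" and B: "B \<in> sets M" "emeasure M B = ennreal \<sigma>" and \<beta>: "0 \<le> \<beta>" "0 < \<sigma>"
    and g: "\<And>s. s \<in> B \<Longrightarrow> \<beta> \<le> nrm V (g s)"
  shows "ennreal (\<beta> * Lp_weight p \<sigma>) \<le> Lp_norm V M p g"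
proof (cases "p = \<infinity>")
  case True
  have "ennreal \<beta> \<le> esssup M (\<lambda>s. ennreal (nrm V (g s)))" (is "_ \<le> ?e")
  proof (rule ccontr)
    assume "\<not> ennreal \<beta> \<le> ?e"
    then have "AE s in M. s \<notin> B"
      using esssup_AE[of "\<lambda>s. ennreal (nrm V (g s))" M] by (auto elim!: eventually_mono dest!: g ennreal_leI)
    then have "emeasure M B = 0" 
      using AE_iff_measurable[OF B(1), of "\<lambda>s. s \<notin> B"] sets.sets_into_space[OF B(1)] by auto
    then show False using B \<beta> by simp
  qed
  then show ?thesis using True by (simp add: Lp_norm_def Lp_weight_def)
next
  case False
  define q where "q = enn2real p"
  have q: "0 < q" using p False unfolding q_def by (subst enn2real_positive_iff) (auto simp: top.not_eq_extremum less_le_trans[OF zero_less_one])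
  define J where "J = (\<integral>\<^sup>+s. ennreal (nrm V (g s) powr q) \<partial>M)"
  have "ennreal (\<beta> powr q * \<sigma>) = ennreal (\<beta> powr q) * emeasure M B" using \<beta> by (simp add: B(2) ennreal_mult')
  also have "\<dots> = (\<integral>\<^sup>+s. ennreal (\<beta> powr q) * indicator B s \<partial>M)" using B(1) by (rule nn_integral_cmult_indicator[symmetric])
  also have "\<dots> \<le> J" unfolding J_def
    using q \<beta> g by (intro nn_integral_mono) (auto simp: indicator_def intro!: ennreal_leI powr_mono2)
  finally have J: "ennreal (\<beta> powr q * \<sigma>) \<le> J" .
  show ?thesis
  proof (cases "J = \<infinity>")
    case True
    then show ?thesis using False unfolding Lp_norm_def Let_def J_def q_def by simp
  next
    case fin: False
    have "\<beta> powr q * \<sigma> \<le> enn2real J" using J \<beta> fin enn2real_mono[OF J] by (simp add: top.not_eq_extremum)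
    then have "(\<beta> powr q * \<sigma>) powr (1 / q) \<le> enn2real J powr (1 / q)" using q \<beta> by (intro powr_mono2) auto
    moreover have "(\<beta> powr q * \<sigma>) powr (1 / q) = \<beta> * \<sigma> powr (1 / q)" using q \<beta> by (simp add: powr_mult powr_powr)
    ultimately show ?thesis using False fin
      unfolding Lp_norm_def Lp_weight_def Let_def J_def q_def by (simp add: ennreal_leI)
  qed
qed

text \<open>The factor \<open>2\<^sup>1\<^sup>/\<^sup>p\<close> is at most \<open>2\<close> for \<open>p \<ge> 1\<close>, so one constant serves all exponents.\<close>

lemma Lp_weight_double:
  assumes "1 \<le> p" "0 < \<sigma>"
  shows "Lp_weight p (2 * \<sigma>) \<le> 2 * Lp_weight p \<sigma>" "0 < Lp_weight p \<sigma>"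
proof -
  show "0 < Lp_weight p \<sigma>" using assms by (simp add: Lp_weight_def)
  have "1 \<le> enn2real p" if "p \<noteq> \<infinity>" using assms(1) that enn2real_mono[of 1 p] by (simp add: top.not_eq_extremum)
  then have "2 powr (1 / enn2real p) \<le> 2 powr 1" if "p \<noteq> \<infinity>" using that by (intro powr_mono) auto
  then show "Lp_weight p (2 * \<sigma>) \<le> 2 * Lp_weight p \<sigma>"
    using assms by (auto simp: Lp_weight_def powr_mult)
qed

section \<open>Failure of maximal regularity\<close>

theorem proposition3p4:
  fixes p :: ennreal and r :: real and I :: "real set"
  assumes "1 \<le> p" and "1 < r"
    and "(\<exists>T>0. I = {0<..<T}) \<or> I = {0<..}"
  shows "\<not> maximal_Lp_regularity (l1_lr r) (diag_dom r) diag_op p I"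
proof
  assume reg: "maximal_Lp_regularity (l1_lr r) (diag_dom r) diag_op p I"
  have r: "1 \<le> r" "0 < r" using assms(2) by auto
  obtain \<tau> where \<tau>: "0 < \<tau>" "{0<..<2 * \<tau>} \<subseteq> I" and I: "I \<subseteq> {0<..}" "I \<in> sets lebesgue"
  proof -
    from assms(3) show ?thesis
    proof (elim disjE exE conjE)
      fix T :: real assume "0 < T" "I = {0<..<T}"
      then show ?thesis by (intro that[of "T / 2"]) auto
    next
      assume "I = {0<..}"
      then show ?thesis by (intro that[of 1]) auto
    qed
  qed
  let ?S = "\<lambda>t. diag_exp (complex_of_real t)"
  let ?M = "lebesgue_on I"
  obtain C where C: "\<And>f. f \<in> Lp_space (l1_lr r) ?M p \<Longrightarrow>
      Lp_norm (l1_lr r) ?M p (\<lambda>t. diag_op (mild_solution (l1_lr r) ?S f t)) \<le> ennreal C * Lp_norm (l1_lr r) ?M p f"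
    using reg complex_banach_l1_lr[OF r(1)] densely_defined_diag_op[OF r(1)] sectorial_diag_op[OF r(1)]
      analytic_semigroup_diag_exp[OF r(2)] generator_diag_exp[OF r(1)]
    unfolding maximal_Lp_regularity_def by blast
  define c where "c = \<tau> * exp (- 2 * \<tau>)"
  define K where "K = max C 0"
  have c: "0 < c" using \<tau> by (simp add: c_def)
  have A: "{0<..<2 * \<tau>} \<in> sets ?M" "emeasure ?M {0<..<2 * \<tau>} \<le> ennreal (2 * \<tau>)"
    using \<tau> I by (auto simp: sets_restrict_space_iff emeasure_restrict_space)
  have sub: "{\<tau>..<2 * \<tau>} \<subseteq> I" using \<tau> by auto
  have B: "{\<tau>..<2 * \<tau>} \<in> sets ?M" "emeasure ?M {\<tau>..<2 * \<tau>} = ennreal \<tau>"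
    using \<tau>(1) sub I by (auto simp: sets_restrict_space_iff emeasure_restrict_space)
  have ineq: "real N * c \<le> 2 * K * real N powr (1 / r)" for N
  proof -
    have "nrm (l1_lr r) (step_data \<tau> N s) = (if s \<in> {0<..<2 * \<tau>} then real N powr (1 / r) else 0)" if "s \<in> space ?M" for s
      using that I(1) nrm_step_data[OF r(2) \<tau>(1), of N s] by (auto simp: space_restrict_space)
    then have upper: "Lp_norm (l1_lr r) ?M p (step_data \<tau> N) \<le> ennreal (real N powr (1 / r) * Lp_weight p (2 * \<tau>))"
      using \<tau> by (intro Lp_norm_le_indicator[OF assms(1) A]) auto
    have mem: "step_data \<tau> N \<in> Lp_space (l1_lr r) ?M p"
      using strongly_measurable_step_data[OF r(1) I(2)] le_less_trans[OF upper] by (simp add: Lp_space_def)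
    have "ennreal (real N * c * Lp_weight p \<tau>) \<le> Lp_norm (l1_lr r) ?M p (\<lambda>t. diag_op (mild_solution (l1_lr r) ?S (step_data \<tau> N) t))"
      using c \<tau> nrm_regular_solution_ge[OF r(1) \<tau>(1)]
      by (intro Lp_norm_ge_indicator[OF assms(1) B]) (auto simp: c_def)
    also have "\<dots> \<le> ennreal C * Lp_norm (l1_lr r) ?M p (step_data \<tau> N)" by (rule C[OF mem])
    also have "\<dots> \<le> ennreal K * ennreal (real N powr (1 / r) * Lp_weight p (2 * \<tau>))"
      using upper by (intro mult_mono ennreal_leI) (auto simp: K_def)
    also have "\<dots> = ennreal (K * (real N powr (1 / r) * Lp_weight p (2 * \<tau>)))"
      by (simp add: K_def ennreal_mult')
    finally have "real N * c * Lp_weight p \<tau> \<le> K * (real N powr (1 / r) * Lp_weight p (2 * \<tau>))"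
      using Lp_weight_double(2)[OF assms(1), of "2 * \<tau>"] \<tau> by (subst (asm) ennreal_le_iff) (auto simp: K_def)
    also have "\<dots> \<le> K * (real N powr (1 / r) * (2 * Lp_weight p \<tau>))"
      using Lp_weight_double(1)[OF assms(1) \<tau>(1)] by (intro mult_left_mono) (auto simp: K_def)
    also have "\<dots> = 2 * K * real N powr (1 / r) * Lp_weight p \<tau>" by simp
    finally show ?thesis using Lp_weight_double(2)[OF assms(1) \<tau>(1)] by simp
  qed
  obtain N :: nat where "(2 * K / c) powr (1 / (1 - 1 / r)) < real N"
    using reals_Archimedean2 by blast
  then have N: "0 < N" "((2 * K / c) powr (1 / (1 - 1 / r))) powr (1 - 1 / r) < real N powr (1 - 1 / r)"
    using assms(2) by (auto intro: powr_less_mono2 gr0I)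
  then have "2 * K / c < real N powr (1 - 1 / r)"
    using assms(2) c by (simp add: powr_powr K_def)
  then have "2 * K < c * real N powr (1 - 1 / r)" using c by (simp add: pos_divide_less_eq mult.commute)
  then have "2 * K * real N powr (1 / r) < c * real N powr (1 - 1 / r) * real N powr (1 / r)"
    using N(1) by (intro mult_strict_right_mono) auto
  also have "\<dots> = real N * c" using N(1) by (simp flip: powr_add)
  finally show False using ineq[of N] by linarith
qed

end
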